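(* Assume [H1]. Then the value function $u$ satisfies $u(x,T)=g(x)$ for all $x\in\mathcal G$, and it is a viscosity solution of $$-\partial_t u+H_i(x,t,Du)=0 \ \text{ for } x\in J_i\setminus\{O\},\qquad -\partial_t u+H_O(t,Du)=0\ \text{ at } x=O,$$ in the following sense: for every $(x,t)\in\mathcal G\times(0,T)$ and every $\varphi\in C^1(\mathcal G\times[0,T])$ such that $u-\varphi$ has a local maximum (resp. local minimum) at $(x,t)$, one has $-\partial_t\varphi(x,t)+H_i(x,t,D\varphi(x,t))\le 0$ (resp. $\ge 0$) if $x\in J_i\setminus\{O\}$, and $-\partial_t\varphi(O,t)+H_O(t,D\varphi(O,t))\le 0$ (resp. $\ge0$) if $x=O$.
   Context: Let $N\ge 2$, $d\ge 1$, and let $e_1,\dots,e_N\in\mathbb R^d$ be pairwise distinct unit vectors. Let $J_i=\{s e_i: s\ge 0\}$, $\mathcal G=\bigcup_{i=1}^N J_i$ and $O=0$, with geodesic distance $d(x,y)=|x-y|$ if $x,y$ lie in a common $J_i$ and $d(x,y)=|x|+|y|$ otherwise. Fix $T>0$. For $i=0,\dots,N$ let $A_i=\{i\}\times\mathbb R$, $A=\bigcup_{i=0}^N A_i$ (disjoint union); for $a=(i,\bar a)$ write $|a|=|\bar a|$. Let $M=\{(x,a): x\in\mathcal G,\ a\in A_i \text{ if } x\in J_i\setminus\{O\},\ a\in A \text{ if } x=O\}$ and $f:M\to\mathbb R^d$, $f(x,(i,\bar a))=\bar a e_i$ for $i\ge1$, $f(O,(0,\bar a))=0$. For $0\le t<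 T$ and $x\in\mathcal G$, $\Gamma_t[x]$ is the set of pairs $(y,\alpha)$ with $y\in W^{1,2}([t,T];\mathcal G)$, $\alpha:[t,T]\to A$ measurable, $(y(s),\alpha(s))\in M$ a.e., $\int|\alpha|^2<\infty$, $y(s)=x+\int_t^s f(y(\tau),\alpha(\tau))d\tau$. [H1]: for $i=1,\dots,N$, $\ell_i:J_i\times[0,T]\to\mathbb R$ and $g_i:J_i\to\mathbb R$ continuous and bounded; $\ell_*:[0,T]\to\mathbb R$ continuous and bounded; $g_*\in\mathbb R$. $\ell_O(t)=\min\{\ell_*(t),\min_i\ell_i(O,t)\}$; $L(x,t)=\ell_i(x,t)$ for $x\in J_i\setminus\{O\}$, $L(O,t)=\ell_O(t)$; $g=g_i$ on $J_i\setminus\{O\}$, $g(O)=\min\{g_*,\min_i g_i(O)\}$. $J_t(x;(y,\alpha))=\int_t^T\big(L(y(\tau),\tau)+\tfrac12|\alpha(\tau)|^2\big)d\tau+g(y(T))$, $u(x,t)=\inf_{\Gamma_t[x]}J_t(x;\cdot)$ for $t<T$ and $u(x,T)=g(x)$. $C^1(\mathcal G\times[0,T])$ is the set of continuous $\varphi$ on $\mathcal G\times[0,T]$ whose restriction to each $J_i\times[0,T]$, viewed as a function of $(\bar x,t)\in\mathbb R^+\times[0,T]$ via $\bar x\mapsto\bar x e_i$, is $C^1$ (one-sided derivatives at the boundary). $D\varphi(x,t)=D\varphi_{|J_i}(x,t)\in\mathbb R$ (derivative in $\bar x$) if $x\in J_i\setminus\{O\}$, and $D\varphi(O,t)=(D\varphi_{|J_1}(O,t),\dots,D\varphi_{|J_N}(O,t))\in\mathbb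 R^N$. Hamiltonians: $H_i(x,t,p)=\sup_{a\in\mathbb R}\{-pa-a^2/2-\ell_i(x,t)\}=p^2/2-\ell_i(x,t)$ for $x\in J_i$, $p\in\mathbb R$; $H_i^{\downarrow}(O,t,p)=\sup_{a\ge 0}\{-pa-a^2/2-\ell_i(O,t)\}$ (which equals $p^2/2-\ell_i(O,t)$ if $p\le 0$ and $-\ell_i(O,t)$ if $p>0$); for $p=(p_1,\dots,p_N)\in\mathbb R^N$, $H_O(t,p)=\max\{-\ell_O(t),\max_{i=1,\dots,N}H_i^{\downarrow}(O,t,p_i)\}$. *)

theory Defs
  imports "HOL-Analysis.Analysis"
begin

text \<open>Edge J_i = {s e_i : s >= 0}; the vertex O is the origin 0.\<close>
definition Jray :: "(nat \<Rightarrow> 'a::euclidean_space) \<Rightarrow> nat \<Rightarrow> 'a set" where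
  "Jray e i = {s *\<^sub>R e i | s. s \<ge> 0}"

definition Gr :: "nat \<Rightarrow> (nat \<Rightarrow> 'a::euclidean_space) \<Rightarrow> 'a set" where
  "Gr N e = (\<Union>i\<in>{1..N}. Jray e i)"

definition gdist :: "nat \<Rightarrow> (nat \<Rightarrow> 'a::euclidean_space) \<Rightarrow> 'a \<Rightarrow> 'a \<Rightarrow> real" where
  "gdist N e x y = (if (\<exists>i\<in>{1..N}. x \<in> Jray e i \<and> y \<in> Jray e i) then norm (x - y)
                    else norm x + norm y)"

text \<open>A control value a = (k, abar) in A = disjoint union of A_0,...,A_N (k the index).
  The set M: at x in J_k minus O only A_k is allowed; at O all of A.\<close>
definition inM :: "nat \<Rightarrow> (nat \<Rightarrow> 'a::euclidean_space) \<Rightarrow> 'a \<Rightarrow> nat \<times> real \<Rightarrow> bool" where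
  "inM N e x ka = (case ka of (k, a) \<Rightarrow>
      (x = 0 \<and> k \<le> N) \<or> (k \<in> {1..N} \<and> x \<in> Jray e k - {0}))"

text \<open>Dynamics f(x,(i,abar)) = abar e_i for i >= 1, f(O,(0,abar)) = 0
  (values outside M are irrelevant).\<close>
definition dynf :: "(nat \<Rightarrow> 'a::euclidean_space) \<Rightarrow> 'a \<Rightarrow> nat \<times> real \<Rightarrow> 'a" where
  "dynf e x ka = (case ka of (k, a) \<Rightarrow> (if k = 0 then 0 else a *\<^sub>R e k))"

definition ellO :: "nat \<Rightarrow> (nat \<Rightarrow> 'a::zero \<Rightarrow> real \<Rightarrow> real) \<Rightarrow> (real \<Rightarrow> real) \<Rightarrow> real \<Rightarrow> real"
  where "ellO N ell ells t = min (ells t) (Min ((\<lambda>i. ell i 0 t) ` {1..N}))"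

definition Lfun :: "nat \<Rightarrow> (nat \<Rightarrow> 'a::euclidean_space) \<Rightarrow> (nat \<Rightarrow> 'a \<Rightarrow> real \<Rightarrow> real) \<Rightarrow> (real \<Rightarrow> real)
                   \<Rightarrow> 'a \<Rightarrow> real \<Rightarrow> real" where
  "Lfun N e ell ells x t =
     (if x = 0 then ellO N ell ells t
      else ell (THE i. i \<in> {1..N} \<and> x \<in> Jray e i) x t)"

definition gfun :: "nat \<Rightarrow> (nat \<Rightarrow> 'a::euclidean_space) \<Rightarrow> (nat \<Rightarrow> 'a \<Rightarrow> real) \<Rightarrow> real \<Rightarrow> 'a \<Rightarrow> real" where
  "gfun N e gi gs x =
     (if x = 0 then min gs (Min ((\<lambda>i. gi i 0) ` {1..N}))
      else gi (THE i. i \<in> {1..N} \<and> x \<in> Jray e i) x)"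

text \<open>A control alpha is represented by its index part k and its real part abar = a.
  The W^{1,2} regularity of y is a consequence of the integral equation with an L^2 control;
  we require y to stay in the junction on [t,T].\<close>
definition Gamma :: "nat \<Rightarrow> (nat \<Rightarrow> 'a::euclidean_space) \<Rightarrow> real \<Rightarrow> real \<Rightarrow> 'a
                     \<Rightarrow> ((real \<Rightarrow> 'a) \<times> (real \<Rightarrow> nat) \<times> (real \<Rightarrow> real)) set" where
  "Gamma N e T t x = {(y, k, a).
      (\<forall>s\<in>{t..T}. y s \<in> Gr N e) \<and>
      (\<forall>s\<in>{t..T}. k s \<le> N) \<and>
      k \<in> measurable (restrict_space lebesgue {t..T}) (count_space UNIV) \<and>
      a \<in> borel_measurable (restrict_space lebesgue {t..T}) \<and>
      (AE s in lebesgue. s \<in> {t..T} \<longrightarrow> inM N e (y s) (k s, a s)) \<and>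
      set_integrable lebesgue {t..T} (\<lambda>s. (a s)\<^sup>2) \<and>
      set_integrable lebesgue {t..T} (\<lambda>s. dynf e (y s) (k s, a s)) \<and>
      (\<forall>s\<in>{t..T}. y s = x + (LINT \<tau>:{t..s}|lebesgue. dynf e (y \<tau>) (k \<tau>, a \<tau>)))}"

definition Jcost :: "nat \<Rightarrow> (nat \<Rightarrow> 'a::euclidean_space) \<Rightarrow> (nat \<Rightarrow> 'a \<Rightarrow> real \<Rightarrow> real) \<Rightarrow> (real \<Rightarrow> real)
                     \<Rightarrow> (nat \<Rightarrow> 'a \<Rightarrow> real) \<Rightarrow> real \<Rightarrow> real \<Rightarrow> real
                     \<Rightarrow> (real \<Rightarrow> 'a) \<times> (real \<Rightarrow> nat) \<times> (real \<Rightarrow> real) \<Rightarrow> real" where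
  "Jcost N e ell ells gi gs T t ya = (case ya of (y, k, a) \<Rightarrow>
      (LINT \<tau>:{t..T}|lebesgue. Lfun N e ell ells (y \<tau>) \<tau> + (a \<tau>)\<^sup>2 / 2)
      + gfun N e gi gs (y T))"

definition ufun :: "nat \<Rightarrow> (nat \<Rightarrow> 'a::euclidean_space) \<Rightarrow> (nat \<Rightarrow> 'a \<Rightarrow> real \<Rightarrow> real) \<Rightarrow> (real \<Rightarrow> real)
                     \<Rightarrow> (nat \<Rightarrow> 'a \<Rightarrow> real) \<Rightarrow> real \<Rightarrow> real \<Rightarrow> 'a \<Rightarrow> real \<Rightarrow> real" where
  "ufun N e ell ells gi gs T x t =
     (if t < T then Inf (Jcost N e ell ells gi gs T t ` Gamma N e T t x)
      else gfun N e gi gs x)"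

definition Hi :: "(nat \<Rightarrow> 'a \<Rightarrow> real \<Rightarrow> real) \<Rightarrow> nat \<Rightarrow> 'a \<Rightarrow> real \<Rightarrow> real \<Rightarrow> real" where
  "Hi ell i x t p = (SUP a\<in>(UNIV::real set). - p * a - a\<^sup>2 / 2 - ell i x t)"

definition Hdown :: "(nat \<Rightarrow> 'a::zero \<Rightarrow> real \<Rightarrow> real) \<Rightarrow> nat \<Rightarrow> real \<Rightarrow> real \<Rightarrow> real" where
  "Hdown ell i t p = (SUP a\<in>{0::real..}. - p * a - a\<^sup>2 / 2 - ell i 0 t)"

definition HO :: "nat \<Rightarrow> (nat \<Rightarrow> 'a::zero \<Rightarrow> real \<Rightarrow> real) \<Rightarrow> (real \<Rightarrow> real) \<Rightarrow> real \<Rightarrow> (nat \<Rightarrow> real) \<Rightarrow> real" where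
  "HO N ell ells t p = max (- ellO N ell ells t)
                          (Max ((\<lambda>i. Hdown ell i t (p i)) ` {1..N}))"

definition C1junction :: "nat \<Rightarrow> (nat \<Rightarrow> 'a::euclidean_space) \<Rightarrow> real \<Rightarrow> ('a \<Rightarrow> real \<Rightarrow> real)
                          \<Rightarrow> (nat \<Rightarrow> real \<Rightarrow> real \<Rightarrow> real) \<Rightarrow> (nat \<Rightarrow> real \<Rightarrow> real \<Rightarrow> real) \<Rightarrow> bool" where
  "C1junction N e T phi Dx Dt \<longleftrightarrow>
     continuous_on (Gr N e \<times> {0..T}) (\<lambda>(x, t). phi x t) \<and>
     (\<forall>i\<in>{1..N}.
        continuous_on ({0..} \<times> {0..T}) (\<lambda>(r, t). Dx i r t) \<and>
        continuous_on ({0..} \<times> {0..T}) (\<lambda>(r, t). Dt i r t) \<and>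
        (\<forall>r\<in>{0::real..}. \<forall>t\<in>{0..T}.
           ((\<lambda>(r', t'). phi (r' *\<^sub>R e i) t') has_derivative
              (\<lambda>(h, k). Dx i r t * h + Dt i r t * k)) (at (r, t) within {0..} \<times> {0..T})))"

definition loc_max_at :: "nat \<Rightarrow> (nat \<Rightarrow> 'a::euclidean_space) \<Rightarrow> real \<Rightarrow> ('a \<Rightarrow> real \<Rightarrow> real) \<Rightarrow> 'a \<Rightarrow> real \<Rightarrow> bool" where
  "loc_max_at N e T w x t \<longleftrightarrow> (\<exists>\<delta>>0. \<forall>y\<in>Gr N e. \<forall>s\<in>{0..T}.
      gdist N e x y < \<delta> \<and> \<bar>s - t\<bar> < \<delta> \<longrightarrow> w y s \<le> w x t)"

definition loc_min_at :: "nat \<Rightarrow> (nat \<Rightarrow> 'a::euclidean_space) \<Rightarrow> real \<Rightarrow> ('a \<Rightarrow> real \<Rightarrow> real) \<Rightarrow> 'a \<Rightarrow> real \<Rightarrow> bool" where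
  "loc_min_at N e T w x t \<longleftrightarrow> (\<exists>\<delta>>0. \<forall>y\<in>Gr N e. \<forall>s\<in>{0..T}.
      gdist N e x y < \<delta> \<and> \<bar>s - t\<bar> < \<delta> \<longrightarrow> w y s \<ge> w x t)"

end

theory Submission
  imports Defs
begin

text \<open>
  Dynamic programming. Subsolution property: following a constant control for a short time and
  continuing optimally gives one competitor for each control value. Supersolution property: a
  nearly optimal trajectory on \<open>[t, r]\<close> stays close to its starting point by the \<open>L\<^sup>2\<close> bound on the
  controls. At the vertex, only its last visit to \<open>O\<close>, at time \<open>w\<close>, matters: on \<open>[t, w]\<close> the
  running cost is essentially at least \<open>\<ell>\<^sub>O\<close>, whereas on \<open>[w, r]\<close> the trajectory stays on one edge
  \<open>J\<^sub>j\<close>, where it pays \<open>\<ell>\<^sub>j\<close> and, by Jensen, at least the kinetic energy of its mean velocity.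
  As \<open>H\<^sub>O\<close> is a maximum of a waiting and a moving Hamiltonian, it dominates the two contributions,
  each weighted with its duration. Only the mean velocity enters, so a first-order expansion
  of the test function at the touching point is enough.
\<close>

section \<open>Preliminaries\<close>

text \<open>A trajectory leaving O may return there infinitely often and change edges each time, so
  no edge can be attached to it from the start. Cutting at the last visit resolves this:
  \<open>y w\<close> is 0, so the motion before \<open>w\<close> contributes no net displacement,
  and all of \<open>norm (y r)\<close> is gained on one edge. The cut also makes the mean velocity
  nonnegative, which is why bounds by the outward Hamiltonians \<open>Hdown\<close> suffice at the
  vertex. The mean velocity has no a priori bound as r tends to t, so the expansion error, \<eta>
  times the displacement, need not be of order r - t. The kinetic term absorbs it: a very large
  velocity does worse than velocity 0. For each \<eta> the desired inequality then holds up to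
  \<eta> times a constant that depends neither on the trajectory nor on r. Neither a minimiser nor a
  limit of trajectories enters: r is fixed first, and then a trajectory is taken that is optimal up
  to \<eta> (r - t), an error proportional to the duration.\<close>

lemma integrable_on_subinterval_real:
  fixes f :: "real \<Rightarrow> 'b::banach"
  assumes "f integrable_on {a..b}" "a \<le> c" "d \<le> b"
  shows "f integrable_on {c..d}"
  using assms integrable_subinterval_real[of f a b c d] by auto

lemma continuous_on_Min_image:
  fixes f :: "'i \<Rightarrow> real \<Rightarrow> real"
  assumes "finite I" "I \<noteq> {}" "\<And>i. i \<in> I \<Longrightarrow> continuous_on S (f i)"
  shows "continuous_on S (\<lambda>t. Min ((\<lambda>i. f i t) ` I))"
  using assms by (induction I rule: finite_ne_induct) (auto intro!: continuous_intros)

text \<open>This is how competitors are glued: a constant before \<open>r\<close>, the data of a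
  given trajectory from \<open>r\<close> on. It is applied to the velocity and to the squared
  control. The conflict of values at \<open>r\<close> sits on a null set.\<close>

lemma
  fixes f :: "real \<Rightarrow> 'b::euclidean_space" and c :: 'b
  assumes f: "f absolutely_integrable_on {r..b}" and r: "t \<le> r" "r \<le> b"
  defines "h \<equiv> \<lambda>s. if s < r then c else f s"
  shows concat_absolutely_integrable: "h absolutely_integrable_on {t..b}"
    and concat_integral_left: "s \<in> {t..r} \<Longrightarrow> integral {t..s} h = (s - t) *\<^sub>R c"
    and concat_integral_right: "s \<in> {r..b} \<Longrightarrow> integral {t..s} h = (r - t) *\<^sub>R c + integral {r..s} f"
proof -
  have "(\<lambda>_. c) absolutely_integrable_on {t..r}"
    by (intro absolutely_integrable_continuous_real continuous_on_const)
  then have left: "h absolutely_integrable_on {t..r}"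
    by (rule absolutely_integrable_spike[where S = "{r}"]) (auto simp: h_def)
  have right: "h absolutely_integrable_on {r..b}"
    using f by (rule absolutely_integrable_spike[where S = "{}"]) (auto simp: h_def)
  show h: "h absolutely_integrable_on {t..b}"
    using left right r by (rule absolutely_integrable_on_combine)
  have const: "integral {t..s} h = (s - t) *\<^sub>R c" if "s \<in> {t..r}" for s
  proof -
    have "integral {t..s} h = integral {t..s} (\<lambda>_. c)"
      by (rule integral_spike[where S = "{r}"]) (use that in \<open>auto simp: h_def\<close>)
    then show ?thesis using that by simp
  qed
  show "s \<in> {t..r} \<Longrightarrow> integral {t..s} h = (s - t) *\<^sub>R c" by (rule const)
  show "integral {t..s} h = (r - t) *\<^sub>R c + integral {r..s} f" if "s \<in> {r..b}"
  proof -
    have "h integrable_on {t..s}"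
      using set_lebesgue_integral_eq_integral(1)[OF h] that
      by (auto intro: integrable_on_subinterval_real)
    then have "integral {t..s} h = integral {t..r} h + integral {r..s} h"
      using Henstock_Kurzweil_Integration.integral_combine[of t r s h] that r by simp
    moreover have "integral {r..s} h = integral {r..s} f"
      by (rule integral_cong) (auto simp: h_def)
    ultimately show ?thesis using const[of r] r by simp
  qed
qed

text \<open>The target space is arbitrary because both components of a control are glued: the edge
  index, valued in a counting space, and the real part.\<close>

lemma concat_measurable:
  fixes r t b :: real
  assumes "f \<in> measurable (lebesgue_on {r..b}) M" "c \<in> space M"
  shows "(\<lambda>s. if s < r then c else f s) \<in> measurable (lebesgue_on {t..b}) M" (is "?h \<in> _")
proof -
  have \<Omega>: "{t..b} \<inter> {..<r} \<in> sets lebesgue" "{t..b} \<inter> {r..} \<in> sets lebesgue"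
    by (intro sets.Int; simp)+
  show ?thesis
  proof (rule measurable_piecewise_restrict)
    show "countable {{t..b} \<inter> {..<r}, {t..b} \<inter> {r..}}" by simp
    show "\<Omega> \<inter> space (lebesgue_on {t..b}) \<in> sets (lebesgue_on {t..b})"
      if W: "\<Omega> \<in> {{t..b} \<inter> {..<r}, {t..b} \<inter> {r..}}" for \<Omega>
    proof -
      have "\<Omega> \<in> sets lebesgue" "\<Omega> \<subseteq> {t..b}" using W \<Omega> by blast+
      then show ?thesis by (simp add: sets_restrict_space_iff Int_absorb2)
    qed
    show "space (lebesgue_on {t..b}) \<subseteq> \<Union>{{t..b} \<inter> {..<r}, {t..b} \<inter> {r..}}" by auto
    show "?h \<in> measurable (restrict_space (lebesgue_on {t..b}) \<Omega>) M"
      if W: "\<Omega> \<in> {{t..b} \<inter> {..<r}, {t..b} \<inter> {r..}}" for \<Omega>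
    proof -
      have eq: "restrict_space (lebesgue_on {t..b}) \<Omega> = lebesgue_on \<Omega>"
      proof -
        have "\<Omega> \<in> sets lebesgue" "\<Omega> \<subseteq> {t..b}" using W \<Omega> by blast+
        then show ?thesis by (simp add: restrict_restrict_space Int_absorb1)
      qed
      consider "\<Omega> = {t..b} \<inter> {..<r}" | "\<Omega> = {t..b} \<inter> {r..}" using W by blast
      then show ?thesis
      proof cases
        case 1
        have "(\<lambda>_. c) \<in> measurable (lebesgue_on \<Omega>) M" using assms(2) by simp
        then show ?thesis unfolding eq by (rule measurable_cong[THEN iffD1, rotated]) (auto simp: 1)
      next
        case 2
        have "f \<in> measurable (lebesgue_on \<Omega>) M"
          using measurable_restrict_mono[OF assms(1), of \<Omega>] 2 by auto
        then show ?thesis unfolding eq by (rule measurable_cong[THEN iffD1, rotated]) (auto simp: 2)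
      qed
    qed
  qed
qed

text \<open>The edge on which a trajectory ends is known only after a radius has been fixed, so the
  expansions of the test function on the finitely many edges must share one radius.\<close>

lemma common_radius:
  fixes P :: "'i \<Rightarrow> real \<Rightarrow> bool"
  assumes "finite I" "\<And>i. i \<in> I \<Longrightarrow> \<exists>d>0. P i d" "\<And>i d d'. P i d \<Longrightarrow> 0 < d' \<Longrightarrow> d' \<le> d \<Longrightarrow> P i d'"
  shows "\<exists>d>0. \<forall>i\<in>I. P i d"
  using assms(1,2)
proof (induction I rule: finite_induct)
  case empty
  show ?case by (auto intro: exI[of _ 1])
next
  case (insert i I)
  obtain d where d: "d > 0" "\<forall>i\<in>I. P i d" using insert by auto
  obtain d' where d': "d' > 0" "P i d'" using insert by auto
  have "\<forall>i\<in>insert i I. P i (min d d')" using d d' assms(3) by (metis insert_iff min.cobounded1 min.cobounded2 min_less_iff_conj)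
  then show ?case using d(1) d'(1) by (intro exI[of _ "min d d'"]) auto
qed

text \<open>The range of \<eta> stops at 1 because \<open>perturbed_hamiltonian\<close> works only
  there.\<close>

lemma le_zero_if_le_all_multiples:
  fixes z :: real
  assumes "K > 0" "\<And>\<eta>. 0 < \<eta> \<Longrightarrow> \<eta> \<le> 1 \<Longrightarrow> z \<le> \<eta> * K"
  shows "z \<le> 0"
proof (rule ccontr)
  assume "\<not> z \<le> 0"
  define \<eta> where "\<eta> = min 1 (z / (2 * K))"
  have "0 < \<eta>" "\<eta> \<le> 1" using \<open>\<not> z \<le> 0\<close> assms(1) unfolding \<eta>_def by auto
  then have "z \<le> \<eta> * K" by (rule assms(2))
  also have "\<dots> \<le> z / (2 * K) * K" using assms(1) unfolding \<eta>_def by (intro mult_right_mono) auto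
  also have "\<dots> = z / 2" using assms(1) by simp
  finally show False using \<open>\<not> z \<le> 0\<close> by simp
qed

text \<open>The term \<eta> |a| is the expansion error per unit time at velocity \<open>a\<close>.
  For moderate \<open>a\<close> it is \<eta> times a constant. Once |a| exceeds 2 (|p| + 1), half
  the square of \<open>a\<close> outweighs |p| |a| + |a|, and velocity 0 does at least as well.
  Restricting \<open>b\<close> to 0 and \<open>a\<close> keeps it nonnegative whenever
  \<open>a\<close> is, as the one-sided Hamiltonian requires.\<close>

lemma perturbed_hamiltonian:
  fixes a p \<eta> :: real
  assumes "0 \<le> \<eta>" "\<eta> \<le> 1"
  obtains b where "b \<in> {0, a}" "- p * a + \<eta> * \<bar>a\<bar> - a\<^sup>2 / 2 \<le> - p * b - b\<^sup>2 / 2 + 2 * \<eta> * (\<bar>p\<bar> + 1)"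
proof (cases "\<bar>a\<bar> \<le> 2 * (\<bar>p\<bar> + 1)")
  case True
  then have "\<eta> * \<bar>a\<bar> \<le> \<eta> * (2 * (\<bar>p\<bar> + 1))" using assms by (intro mult_left_mono)
  then show ?thesis by (intro that[of a]) (auto simp: algebra_simps)
next
  case False
  have "- p * a \<le> \<bar>p\<bar> * \<bar>a\<bar>" by (metis abs_ge_self abs_minus_cancel abs_mult)
  moreover have "\<eta> * \<bar>a\<bar> \<le> 1 * \<bar>a\<bar>" using assms by (intro mult_right_mono) auto
  moreover have "2 * (\<bar>p\<bar> + 1) * \<bar>a\<bar> \<le> \<bar>a\<bar> * \<bar>a\<bar>" using False by (intro mult_right_mono) auto
  moreover have "\<bar>a\<bar> * \<bar>a\<bar> = a\<^sup>2" by (simp add: power2_eq_square abs_mult_self_eq)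
  moreover have "0 \<le> 2 * \<eta> * (\<bar>p\<bar> + 1)" using assms by simp
  ultimately show ?thesis by (intro that[of 0]) (auto simp: algebra_simps)
qed

text \<open>Here \<open>h\<close> is the total duration, \<open>m\<close> that of the final leg,
  \<rho> the change of distance to O along it, \<open>l0\<close> and \<open>l\<close> the costs of
  waiting and moving, \<open>p\<close> and \<open>q\<close> the derivatives of the test function. In
  the constant, 5 = 3 + 2: running costs, near-optimality and the time part of the expansion lose
  \<eta> \<open>h\<close> each, and \<open>perturbed_hamiltonian\<close> adds 2 |p| + 2.\<close>

lemma supersolution_arith:
  fixes m h \<eta> H l0 l p q \<rho> :: real
  assumes m: "0 < m" "m \<le> h" and \<eta>: "0 \<le> \<eta>" "\<eta> \<le> 1"
    and H0: "(h - m) * (- l0) \<le> (h - m) * H"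
    and H: "\<And>b. b \<in> {0, \<rho> / m} \<Longrightarrow> - p * b - b\<^sup>2 / 2 - l \<le> H"
    and main: "(h - m) * (l0 - \<eta>) + (m * (l - \<eta>) + (\<rho> / m)\<^sup>2 * m / 2) - \<eta> * h \<le>
      - p * \<rho> - q * h + \<eta> * (\<bar>\<rho>\<bar> + h)"
  shows "q - H \<le> \<eta> * (2 * \<bar>p\<bar> + 5)"
proof -
  define a where "a = \<rho> / m"
  have \<rho>: "\<rho> = m * a" "\<bar>\<rho>\<bar> = m * \<bar>a\<bar>" using m unfolding a_def by (auto simp: abs_mult)
  obtain b where b: "b \<in> {0, a}" "- p * a + \<eta> * \<bar>a\<bar> - a\<^sup>2 / 2 \<le> - p * b - b\<^sup>2 / 2 + 2 * \<eta> * (\<bar>p\<bar> + 1)"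
    using perturbed_hamiltonian[OF \<eta>] by metis
  have "- p * a + \<eta> * \<bar>a\<bar> - a\<^sup>2 / 2 - l \<le> H + 2 * \<eta> * (\<bar>p\<bar> + 1)"
    using b(2) H[of b] b(1) unfolding a_def by fastforce
  then have "m * (- p * a + \<eta> * \<bar>a\<bar> - a\<^sup>2 / 2 - l) \<le> m * (H + 2 * \<eta> * (\<bar>p\<bar> + 1))"
    using m by (intro mult_left_mono) auto
  moreover have "m * (2 * \<eta> * (\<bar>p\<bar> + 1)) \<le> h * (2 * \<eta> * (\<bar>p\<bar> + 1))"
    using m \<eta> by (intro mult_right_mono) auto
  moreover have "(h - m) * (l0 - \<eta>) + (m * (l - \<eta>) + a\<^sup>2 * m / 2) - \<eta> * h \<le>
      - p * (m * a) - q * h + \<eta> * (m * \<bar>a\<bar> + h)"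
    using main unfolding \<rho>(2)[symmetric] \<rho>(1)[symmetric] unfolding a_def .
  ultimately have "h * (q - H) \<le> h * (\<eta> * (2 * \<bar>p\<bar> + 5))"
    using H0 by (simp add: algebra_simps)
  then show ?thesis using m by simp
qed

section \<open>Hamiltonians as suprema over the controls\<close>

lemma bdd_above_hamiltonian: "bdd_above ((\<lambda>a::real. - p * a - a\<^sup>2 / 2 - l) ` A)"
proof (rule bdd_aboveI2)
  show "- p * a - a\<^sup>2 / 2 - l \<le> p\<^sup>2 / 2 - l" for a
    \<comment> \<open>Completing the square: the maximum is at a = -p.\<close>
    using zero_le_power2[of "p + a"] by (simp add: power2_eq_square algebra_simps)
qed

lemma Hi_ge: "- p * a - a\<^sup>2 / 2 - ell i x t \<le> Hi ell i x t p"
  unfolding Hi_def using bdd_above_hamiltonian by (intro cSUP_upper) auto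

lemma Hdown_ge: "0 \<le> a \<Longrightarrow> - p * a - a\<^sup>2 / 2 - ell i 0 t \<le> Hdown ell i t p"
  unfolding Hdown_def using bdd_above_hamiltonian by (intro cSUP_upper) auto

lemma Hdown_le_HO: "i \<in> {1..N} \<Longrightarrow> Hdown ell i t (p i) \<le> HO N ell ells t p"
  unfolding HO_def by (intro max.coboundedI2 Min_le Max_ge) auto

section \<open>Junction geometry and costs\<close>

locale junction =
  fixes N :: nat and e :: "nat \<Rightarrow> 'a::euclidean_space" and T :: real
    and ell :: "nat \<Rightarrow> 'a \<Rightarrow> real \<Rightarrow> real" and ells :: "real \<Rightarrow> real"
    and gi :: "nat \<Rightarrow> 'a \<Rightarrow> real" and gs :: real
  assumes N1: "1 \<le> N"
    and unit: "\<forall>i\<in>{1..N}. norm (e i) = 1"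
    and distinct: "inj_on e {1..N}"
    and ell_cont: "\<forall>i\<in>{1..N}. continuous_on (Jray e i \<times> {0..T}) (\<lambda>(x, t). ell i x t)"
    and ell_bdd: "\<forall>i\<in>{1..N}. bounded ((\<lambda>(x, t). ell i x t) ` (Jray e i \<times> {0..T}))"
    and g_bdd: "\<forall>i\<in>{1..N}. bounded (gi i ` Jray e i)"
    and ells_cont: "continuous_on {0..T} ells"
    and ells_bdd: "bounded (ells ` {0..T})"
begin

abbreviation "L \<equiv> Lfun N e ell ells"
abbreviation "lO \<equiv> ellO N ell ells"
abbreviation "g \<equiv> gfun N e gi gs"
abbreviation "J \<equiv> Jcost N e ell ells gi gs T"
abbreviation "u \<equiv> ufun N e ell ells gi gs T"
abbreviation "\<Gamma> \<equiv> Gamma N e T"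

lemma norm_e: "i \<in> {1..N} \<Longrightarrow> norm (e i) = 1"
  using unit by blast

lemma zero_in_Jray: "0 \<in> Jray e i"
  unfolding Jray_def by (force intro: exI[of _ "0::real"])

lemma Jray_scaleR: "r \<ge> 0 \<Longrightarrow> r *\<^sub>R e i \<in> Jray e i"
  unfolding Jray_def by blast

lemma Jray_eq: "i \<in> {1..N} \<Longrightarrow> x \<in> Jray e i \<Longrightarrow> x = norm x *\<^sub>R e i"
  unfolding Jray_def by (auto simp: norm_e)

lemma Jray_subset_Gr: "i \<in> {1..N} \<Longrightarrow> x \<in> Jray e i \<Longrightarrow> x \<in> Gr N e"
  unfolding Gr_def by blast

lemma GrE:
  assumes "x \<in> Gr N e"
  obtains i where "i \<in> {1..N}" "x \<in> Jray e i"
  using assms unfolding Gr_def by blast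

lemma norm_diff_Jray:
  assumes "i \<in> {1..N}" "x \<in> Jray e i" "y \<in> Jray e i"
  shows "norm (x - y) = \<bar>norm x - norm y\<bar>"
proof -
  have "x - y = (norm x - norm y) *\<^sub>R e i"
    using Jray_eq[OF assms(1,2)] Jray_eq[OF assms(1,3)] by (metis scaleR_left_diff_distrib)
  then show ?thesis using norm_e[OF assms(1)] by simp
qed

lemma Jray_unique:
  assumes "i \<in> {1..N}" "j \<in> {1..N}" "x \<in> Jray e i" "x \<in> Jray e j" "x \<noteq> 0"
  shows "i = j"
proof -
  have "norm x *\<^sub>R e i = norm x *\<^sub>R e j"
    using Jray_eq assms by metis
  then have "e i = e j" using \<open>x \<noteq> 0\<close> by simp
  then show ?thesis using distinct assms by (meson inj_onD)
qed

lemma Jray_THE: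
  assumes "i \<in> {1..N}" "x \<in> Jray e i" "x \<noteq> 0"
  shows "(THE j. j \<in> {1..N} \<and> x \<in> Jray e j) = i"
  using assms Jray_unique by (intro the_equality) auto

text \<open>Closed edges make the pieces in the measurability proof for the running cost measurable,
  and let a path that stays on one edge do so up to its endpoint.\<close>

lemma closed_Jray: assumes "i \<in> {1..N}" shows "closed (Jray e i)"
proof -
  have "Jray e i = {x. x = norm x *\<^sub>R e i}"
    using Jray_eq[OF assms] Jray_scaleR by (auto, metis norm_ge_zero)
  also have "closed \<dots>" by (intro closed_Collect_eq continuous_intros)
  finally show ?thesis .
qed

section \<open>The running cost: its jump at the vertex, bounds, and local estimates\<close>

lemma L_0: "L 0 s = lO s"
  unfolding Lfun_def by simp

lemma L_ray: "i \<in> {1..N} \<Longrightarrow> x \<in> Jray e i \<Longrightarrow> x \<noteq> 0 \<Longrightarrow> L x s = ell i x s"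
  using Jray_THE[of i x] unfolding Lfun_def by simp

lemma lO_le: "i \<in> {1..N} \<Longrightarrow> lO s \<le> ell i 0 s"
  unfolding ellO_def by (intro min.coboundedI2 Min_le) auto

text \<open>The cost can only drop at O, so upper bounds by the cost of an edge survive when a
  competitor on that edge starts at O.\<close>

lemma L_le_ell: "i \<in> {1..N} \<Longrightarrow> x \<in> Jray e i \<Longrightarrow> L x s \<le> ell i x s"
  using L_0 L_ray lO_le by (cases "x = 0") auto

lemma continuous_on_ell:
  assumes "i \<in> {1..N}" "continuous_on S y" "continuous_on S s"
    "\<And>r. r \<in> S \<Longrightarrow> y r \<in> Jray e i" "\<And>r. r \<in> S \<Longrightarrow> s r \<in> {0..T}"
  shows "continuous_on S (\<lambda>r. ell i (y r) (s r))"
proof -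
  have "continuous_on (Jray e i \<times> {0..T}) (\<lambda>(x, t). ell i x t)"
    using ell_cont assms(1) by blast
  moreover have "continuous_on S (\<lambda>r. (y r, s r))" by (intro continuous_on_Pair assms)
  moreover have "(\<lambda>r. (y r, s r)) ` S \<subseteq> Jray e i \<times> {0..T}"
    using assms(4,5) by blast
  ultimately have "continuous_on S (\<lambda>r. (\<lambda>(x, t). ell i x t) (y r, s r))"
    by (rule continuous_on_compose2)
  then show ?thesis by simp
qed

lemma continuous_on_lO: "continuous_on {0..T} lO"
proof -
  have "continuous_on {0..T} (\<lambda>s. ell i 0 s)" if "i \<in> {1..N}" for i
    using continuous_on_ell[OF that, of "{0..T}" "\<lambda>_. 0" "\<lambda>s. s"] zero_in_Jray by simp
  then have "continuous_on {0..T} (\<lambda>t. Min ((\<lambda>i. ell i 0 t) ` {1..N}))"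
    using N1 by (intro continuous_on_Min_image) auto
  then show ?thesis unfolding ellO_def by (intro continuous_on_min ells_cont)
qed

lemma running_and_final_bound:
  obtains C where "C \<ge> 0" "\<And>x s. x \<in> Gr N e \<Longrightarrow> s \<in> {0..T} \<Longrightarrow> \<bar>L x s\<bar> \<le> C"
    "\<And>x. x \<in> Gr N e \<Longrightarrow> \<bar>g x\<bar> \<le> C"
proof -
  obtain B where B: "\<And>i x s. i \<in> {1..N} \<Longrightarrow> x \<in> Jray e i \<Longrightarrow> s \<in> {0..T} \<Longrightarrow> \<bar>ell i x s\<bar> \<le> B"
  proof -
    have "bounded (\<Union>i\<in>{1..N}. (\<lambda>(x, t). ell i x t) ` (Jray e i \<times> {0..T}))"
      using ell_bdd by (intro bounded_UN) auto
    then obtain B where "\<forall>z\<in>(\<Union>i\<in>{1..N}. (\<lambda>(x, t). ell i x t) ` (Jray e i \<times> {0..T})). norm z \<le> B"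
      unfolding bounded_iff by blast
    then show ?thesis by (intro that[of B]) fastforce
  qed
  obtain B' where B': "\<And>i x. i \<in> {1..N} \<Longrightarrow> x \<in> Jray e i \<Longrightarrow> \<bar>gi i x\<bar> \<le> B'"
  proof -
    have "bounded (\<Union>i\<in>{1..N}. gi i ` Jray e i)"
      using g_bdd by (intro bounded_UN) auto
    then obtain B where "\<forall>z\<in>(\<Union>i\<in>{1..N}. gi i ` Jray e i). norm z \<le> B"
      unfolding bounded_iff by blast
    then show ?thesis by (intro that[of B]) fastforce
  qed
  obtain D where D: "\<And>s. s \<in> {0..T} \<Longrightarrow> \<bar>ells s\<bar> \<le> D"
    using ells_bdd unfolding bounded_iff by (metis imageI real_norm_def)
  define C where "C = \<bar>B\<bar> + \<bar>B'\<bar> + \<bar>D\<bar> + \<bar>gs\<bar>"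
  have Min_bd: "\<bar>min p (Min (f ` {1..N}))\<bar> \<le> C"
    if "\<bar>p\<bar> \<le> C" "\<And>i. i \<in> {1..N} \<Longrightarrow> \<bar>f i\<bar> \<le> C" for p :: real and f :: "nat \<Rightarrow> real"
  proof -
    have "Min (f ` {1..N}) \<in> f ` {1..N}" using N1 by (intro Min_in) auto
    then show ?thesis using that by (auto simp: min_def)
  qed
  show ?thesis
  proof (rule that[of C])
    show "C \<ge> 0" unfolding C_def by simp
    show "\<bar>L x s\<bar> \<le> C" if in_dom: "x \<in> Gr N e" "s \<in> {0..T}" for x s
    proof (cases "x = 0")
      case True
      have "\<bar>lO s\<bar> \<le> C" unfolding ellO_def
      proof (rule Min_bd)
        show "\<bar>ells s\<bar> \<le> C" using D[OF in_dom(2)] unfolding C_def by linarith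
        show "\<bar>ell i 0 s\<bar> \<le> C" if "i \<in> {1..N}" for i
          using B[OF that zero_in_Jray \<open>s \<in> {0..T}\<close>] unfolding C_def by linarith
      qed
      then show ?thesis using True L_0 by simp
    next
      case False
      obtain i where i: "i \<in> {1..N}" "x \<in> Jray e i" using GrE in_dom(1) by blast
      show ?thesis using B[OF i in_dom(2)] L_ray[OF i False] unfolding C_def by simp
    qed
    show "\<bar>g x\<bar> \<le> C" if in_dom: "x \<in> Gr N e" for x
    proof (cases "x = 0")
      case True
      have "\<bar>min gs (Min ((\<lambda>i. gi i 0) ` {1..N}))\<bar> \<le> C"
      proof (rule Min_bd)
        show "\<bar>gs\<bar> \<le> C" unfolding C_def by linarith
        show "\<bar>gi i 0\<bar> \<le> C" if "i \<in> {1..N}" for i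
          using B'[OF that zero_in_Jray] unfolding C_def by linarith
      qed
      then show ?thesis using True unfolding gfun_def by simp
    next
      case False
      obtain i where i: "i \<in> {1..N}" "x \<in> Jray e i" using GrE in_dom(1) by blast
      show ?thesis using B'[OF i] False Jray_THE[OF i False]
        unfolding gfun_def C_def by simp
    qed
  qed
qed

lemma ell_near:
  assumes "i \<in> {1..N}" "x \<in> Jray e i" "t \<in> {0..T}" "\<eta> > 0"
  obtains \<delta> where "\<delta> > 0"
    "\<And>y s. y \<in> Jray e i \<Longrightarrow> s \<in> {0..T} \<Longrightarrow> norm (y - x) < \<delta> \<Longrightarrow> \<bar>s - t\<bar> < \<delta> \<Longrightarrow>
       \<bar>ell i y s - ell i x t\<bar> < \<eta>"
proof -
  have "continuous_on (Jray e i \<times> {0..T}) (\<lambda>(x, t). ell i x t)" using ell_cont assms by blast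
  then obtain d where d: "d > 0" "\<forall>z\<in>Jray e i \<times> {0..T}. dist z (x, t) < d \<longrightarrow>
      dist (case z of (x, t) \<Rightarrow> ell i x t) (ell i x t) < \<eta>"
    unfolding continuous_on_iff using assms by (metis (no_types, lifting) SigmaI case_prod_conv)
  show ?thesis
  proof (rule that[of "d / 2"])
    show "d / 2 > 0" using d by simp
    fix y s assume *: "y \<in> Jray e i" "s \<in> {0..T}" "norm (y - x) < d / 2" "\<bar>s - t\<bar> < d / 2"
    have "dist (y, s) (x, t) \<le> dist y x + dist s t"
      unfolding dist_Pair_Pair by (rule sqrt_sum_squares_le_sum) auto
    also have "\<dots> < d" using * by (simp add: dist_norm)
    finally show "\<bar>ell i y s - ell i x t\<bar> < \<eta>"
      using d(2) * by (auto simp: dist_real_def dest: bspec[of _ _ "(y, s)"])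
  qed
qed

lemma lO_near:
  assumes "t \<in> {0..T}" "\<eta> > 0"
  obtains \<delta> where "\<delta> > 0" "\<And>s. s \<in> {0..T} \<Longrightarrow> \<bar>s - t\<bar> < \<delta> \<Longrightarrow> \<bar>lO s - lO t\<bar> < \<eta>"
  using continuous_on_lO assms unfolding continuous_on_iff dist_real_def by metis

text \<open>Two lower bounds for two phases: the weak one holds whatever edges are visited, as
  \<open>lO\<close> is below every edge cost, and serves until the last visit to O; the sharp one
  needs a position off O on a known edge and serves afterwards.\<close>

lemma L_near_vertex:
  assumes "t \<in> {0..T}" "\<eta> > 0"
  obtains \<delta> where "\<delta> > 0"
    "\<And>y s. y \<in> Gr N e \<Longrightarrow> s \<in> {0..T} \<Longrightarrow> norm y < \<delta> \<Longrightarrow> \<bar>s - t\<bar> < \<delta> \<Longrightarrow> lO t - \<eta> \<le> L y s"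
    "\<And>i y s. i \<in> {1..N} \<Longrightarrow> y \<in> Jray e i \<Longrightarrow> y \<noteq> 0 \<Longrightarrow> s \<in> {0..T} \<Longrightarrow> norm y < \<delta> \<Longrightarrow> \<bar>s - t\<bar> < \<delta> \<Longrightarrow>
       ell i 0 t - \<eta> \<le> L y s"
proof -
  obtain d0 where d0: "d0 > 0" "\<And>s. s \<in> {0..T} \<Longrightarrow> \<bar>s - t\<bar> < d0 \<Longrightarrow> \<bar>lO s - lO t\<bar> < \<eta>"
    using lO_near assms by blast
  have "\<forall>i\<in>{1..N}. \<exists>d>0. \<forall>y s. y \<in> Jray e i \<longrightarrow> s \<in> {0..T} \<longrightarrow> norm y < d \<longrightarrow> \<bar>s - t\<bar> < d \<longrightarrow>
       \<bar>ell i y s - ell i 0 t\<bar> < \<eta>"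
    using ell_near[OF _ zero_in_Jray assms] by (metis diff_zero)
  then obtain d where d: "\<And>i. i \<in> {1..N} \<Longrightarrow> d i > 0" "\<And>i y s. i \<in> {1..N} \<Longrightarrow> y \<in> Jray e i \<Longrightarrow>
      s \<in> {0..T} \<Longrightarrow> norm y < d i \<Longrightarrow> \<bar>s - t\<bar> < d i \<Longrightarrow> \<bar>ell i y s - ell i 0 t\<bar> < \<eta>"
    by metis
  define \<delta> where "\<delta> = Min (insert d0 (d ` {1..N}))"
  have le: "\<delta> \<le> d0" "\<And>i. i \<in> {1..N} \<Longrightarrow> \<delta> \<le> d i" unfolding \<delta>_def by (rule Min_le; simp)+
  have ray: "ell i 0 t - \<eta> \<le> L y s"
    if "i \<in> {1..N}" "y \<in> Jray e i" "y \<noteq> 0" "s \<in> {0..T}" "norm y < \<delta>" "\<bar>s - t\<bar> < \<delta>" for i y s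
    using d(2)[of i y s] le(2)[of i] that L_ray[of i y s] by force
  show ?thesis
  proof (rule that[of \<delta>])
    show "\<delta> > 0" unfolding \<delta>_def using d0(1) d(1) by (subst Min_gr_iff) auto
    show "lO t - \<eta> \<le> L y s"
      if *: "y \<in> Gr N e" "s \<in> {0..T}" "norm y < \<delta>" "\<bar>s - t\<bar> < \<delta>" for y s
    proof (cases "y = 0")
      case True
      then show ?thesis using d0(2)[of s] * le(1) L_0 by force
    next
      case False
      obtain i where i: "i \<in> {1..N}" "y \<in> Jray e i" using GrE * by blast
      show ?thesis using ray[OF i False *(2-4)] lO_le[OF i(1), of t] by linarith
    qed
  qed (use ray in blast)
qed

section \<open>Trajectories and dynamic programming\<close>

text \<open>The dynamics do not depend on the position, so the velocity is a function of time alone,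
  determined by the control.\<close>

definition velocity :: "(real \<Rightarrow> nat) \<Rightarrow> (real \<Rightarrow> real) \<Rightarrow> real \<Rightarrow> 'a" where
  "velocity k a s = (if k s = 0 then 0 else a s *\<^sub>R e (k s))"

lemma dynf_eq_velocity: "dynf e x (k s, a s) = velocity k a s"
  unfolding dynf_def velocity_def by simp

text \<open>Restates admissibility with gauge integrals, whose rules for adjacent intervals and null
  sets are used throughout.\<close>

lemma Gamma_iff:
  "(y, k, a) \<in> \<Gamma> t x \<longleftrightarrow>
    (\<forall>s\<in>{t..T}. y s \<in> Gr N e) \<and> (\<forall>s\<in>{t..T}. k s \<le> N) \<and>
    k \<in> measurable (lebesgue_on {t..T}) (count_space UNIV) \<and>
    a \<in> borel_measurable (lebesgue_on {t..T}) \<and>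
    (AE s in lebesgue. s \<in> {t..T} \<longrightarrow> inM N e (y s) (k s, a s)) \<and>
    (\<lambda>s. (a s)\<^sup>2) absolutely_integrable_on {t..T} \<and>
    velocity k a absolutely_integrable_on {t..T} \<and>
    (\<forall>s\<in>{t..T}. y s = x + integral {t..s} (velocity k a))"
proof -
  have "(LINT \<tau>:{t..s}|lebesgue. velocity k a \<tau>) = integral {t..s} (velocity k a)"
    if "velocity k a absolutely_integrable_on {t..T}" "s \<in> {t..T}" for s
    using that by (intro set_lebesgue_integral_eq_integral absolutely_integrable_on_subinterval) auto
  moreover have "(\<lambda>s. velocity k a s) = velocity k a" by simp
  ultimately show ?thesis
    unfolding Gamma_def mem_Collect_eq case_prod_conv dynf_eq_velocity
    \<comment> \<open>The two integrals agree only for an absolutely integrable velocity;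
      \<open>conj_cong\<close> makes the preceding conjunct available to prove this.\<close>
    by (intro conj_cong ball_cong refl) simp
qed

lemma trajectory:
  assumes "(y, k, a) \<in> \<Gamma> t x"
  shows trajectory_Gr: "s \<in> {t..T} \<Longrightarrow> y s \<in> Gr N e"
    and trajectory_le_N: "s \<in> {t..T} \<Longrightarrow> k s \<le> N"
    and trajectory_k_measurable: "k \<in> measurable (lebesgue_on {t..T}) (count_space UNIV)"
    and trajectory_a_measurable: "a \<in> borel_measurable (lebesgue_on {t..T})"
    and trajectory_inM: "AE s in lebesgue. s \<in> {t..T} \<longrightarrow> inM N e (y s) (k s, a s)"
    and trajectory_square: "(\<lambda>s. (a s)\<^sup>2) absolutely_integrable_on {t..T}"
    and trajectory_velocity: "velocity k a absolutely_integrable_on {t..T}"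
    and trajectory_eq: "s \<in> {t..T} \<Longrightarrow> y s = x + integral {t..s} (velocity k a)"
  using assms unfolding Gamma_iff by blast+

lemma trajectory_start:
  assumes "(y, k, a) \<in> \<Gamma> t x" "t \<le> T" shows "y t = x"
  using trajectory_eq[OF assms(1), of t] assms(2) by simp

lemma trajectory_increment:
  assumes "(y, k, a) \<in> \<Gamma> t x" "t \<le> r" "r \<le> s" "s \<le> T"
  shows "y s = y r + integral {r..s} (velocity k a)"
proof -
  have "velocity k a integrable_on {t..T}"
    using trajectory_velocity[OF assms(1)] by (rule set_lebesgue_integral_eq_integral)
  then have "velocity k a integrable_on {t..s}"
    using assms by (elim integrable_on_subinterval_real) auto
  then have "integral {t..r} (velocity k a) + integral {r..s} (velocity k a) = integral {t..s} (velocity k a)"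
    using assms by (intro Henstock_Kurzweil_Integration.integral_combine)
  then show ?thesis
    using trajectory_eq[OF assms(1), of r] trajectory_eq[OF assms(1), of s] assms by simp
qed

lemma trajectory_tail:
  assumes "(y, k, a) \<in> \<Gamma> t x" "t \<le> r" "r \<le> T"
  shows "(y, k, a) \<in> \<Gamma> r (y r)"
proof -
  have sub: "{r..T} \<subseteq> {t..T}" using assms by auto
  have "AE s in lebesgue. s \<in> {r..T} \<longrightarrow> inM N e (y s) (k s, a s)"
    using trajectory_inM[OF assms(1)] by eventually_elim (use sub in auto)
  moreover have "(\<lambda>s. (a s)\<^sup>2) absolutely_integrable_on {r..T}"
    "velocity k a absolutely_integrable_on {r..T}"
    using trajectory_square[OF assms(1)] trajectory_velocity[OF assms(1)] sub
    by (blast intro: absolutely_integrable_on_subinterval)+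
  moreover have "\<forall>s\<in>{r..T}. y s = y r + integral {r..s} (velocity k a)"
    using trajectory_increment[OF assms(1,2)] by (meson atLeastAtMost_iff)
  moreover have "k \<in> measurable (lebesgue_on {r..T}) (count_space UNIV)"
    "a \<in> borel_measurable (lebesgue_on {r..T})"
    using measurable_restrict_mono[OF trajectory_k_measurable[OF assms(1)] sub]
      measurable_restrict_mono[OF trajectory_a_measurable[OF assms(1)] sub] .
  moreover have "\<forall>s\<in>{r..T}. y s \<in> Gr N e" "\<forall>s\<in>{r..T}. k s \<le> N"
    using trajectory_Gr[OF assms(1)] trajectory_le_N[OF assms(1)] sub by blast+
  ultimately show ?thesis unfolding Gamma_iff by (intro conjI)
qed

lemma trajectory_continuous:
  assumes "(y, k, a) \<in> \<Gamma> t x" shows "continuous_on {t..T} y"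
proof -
  have "continuous_on {t..T} (\<lambda>s. x + integral {t..s} (velocity k a))"
    using trajectory_velocity[OF assms]
    by (intro continuous_on_add continuous_on_const indefinite_integral_continuous_1
        set_lebesgue_integral_eq_integral)
  then show ?thesis by (rule continuous_on_eq) (simp add: trajectory_eq[OF assms])
qed

text \<open>The integrand jumps whenever the path enters or leaves O. The interval is therefore
  split into the closed set \<open>Z\<close> of visits and, for each edge, the times spent there off
  O. On each of these finitely many measurable pieces the integrand is continuous, and it is bounded
  overall.\<close>

lemma running_cost_absolutely_integrable:
  assumes "continuous_on {t..T} y" "\<And>s. s \<in> {t..T} \<Longrightarrow> y s \<in> Gr N e" "0 \<le> t"
  shows "(\<lambda>s. L (y s) s) absolutely_integrable_on {t..T}"
proof -
  obtain C where C: "C \<ge> 0" "\<And>x s. x \<in> Gr N e \<Longrightarrow> s \<in> {0..T} \<Longrightarrow> \<bar>L x s\<bar> \<le> C"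
    "\<And>x. x \<in> Gr N e \<Longrightarrow> \<bar>g x\<bar> \<le> C"
    using running_and_final_bound by blast
  let ?D = "{t..T}" and ?f = "\<lambda>s. L (y s) s"
  define Z where "Z = {s \<in> ?D. y s = 0}"
  define U where "U i = {s \<in> ?D. y s \<in> Jray e i} - Z" for i
  have "closed (?D \<inter> y -` {0})" "\<And>i. i \<in> {1..N} \<Longrightarrow> closed (?D \<inter> y -` Jray e i)"
    using assms(1) closed_Jray by (auto intro!: continuous_closed_preimage)
  moreover have "Z = ?D \<inter> y -` {0}" "\<And>i. U i = (?D \<inter> y -` Jray e i) - Z"
    unfolding Z_def U_def by auto
  ultimately have sets: "Z \<in> sets lebesgue" "\<And>i. i \<in> {1..N} \<Longrightarrow> U i \<in> sets lebesgue"
    by (auto intro!: sets.Diff)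
  have sub: "Z \<subseteq> ?D" "\<And>i. U i \<subseteq> ?D" unfolding Z_def U_def by auto
  have "continuous_on Z lO"
    by (rule continuous_on_subset[OF continuous_on_lO]) (use sub(1) assms(3) in auto)
  then have Z: "continuous_on Z ?f"
    by (rule continuous_on_eq) (simp add: Z_def L_0)
  have U: "continuous_on (U i) ?f" if i: "i \<in> {1..N}" for i
  proof -
    have "continuous_on (U i) (\<lambda>s. ell i (y s) s)"
      using sub(2)[of i] assms(3)
      by (intro continuous_on_ell[OF i] continuous_on_subset[OF assms(1)]) (auto simp: U_def)
    then show ?thesis
      by (rule continuous_on_eq) (use i in \<open>auto simp: U_def Z_def L_ray\<close>)
  qed
  have "?f \<in> borel_measurable (lebesgue_on ?D)"
  proof (rule measurable_piecewise_restrict)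
    show "countable (insert Z (U ` {1..N}))" by simp
    show "\<Omega> \<inter> space (lebesgue_on ?D) \<in> sets (lebesgue_on ?D)"
      if "\<Omega> \<in> insert Z (U ` {1..N})" for \<Omega>
    proof -
      have "\<Omega> \<in> sets lebesgue" "\<Omega> \<subseteq> ?D" using that sets sub by auto
      then show ?thesis by (auto simp: sets_restrict_space_iff Int_absorb2)
    qed
    show "space (lebesgue_on ?D) \<subseteq> \<Union>(insert Z (U ` {1..N}))"
      using assms(2) unfolding Z_def U_def Gr_def by fastforce
    show "?f \<in> borel_measurable (restrict_space (lebesgue_on ?D) \<Omega>)"
      if "\<Omega> \<in> insert Z (U ` {1..N})" for \<Omega>
    proof -
      have "\<Omega> \<in> sets lebesgue" "\<Omega> \<subseteq> ?D" "continuous_on \<Omega> ?f" using that sets sub Z U by auto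
      then show ?thesis
        by (simp add: restrict_restrict_space Int_absorb1 continuous_imp_measurable_on_sets_lebesgue)
    qed
  qed
  moreover have "norm (L (y s) s) \<le> C" if "s \<in> {t..T}" for s
    using C(2)[OF assms(2)[OF that], of s] that assms(3) by simp
  ultimately show ?thesis
    by (intro measurable_bounded_by_integrable_imp_absolutely_integrable[where g = "\<lambda>_. C"]) auto
qed

section \<open>The cost functional: splitting in time and coercivity\<close>

abbreviation "cost y a s \<equiv> L (y s) s + (a s)\<^sup>2 / 2"

lemma cost_absolutely_integrable:
  assumes "(y, k, a) \<in> \<Gamma> t x" "0 \<le> t"
  shows "(\<lambda>s. cost y a s) absolutely_integrable_on {t..T}"
  using running_cost_absolutely_integrable[OF trajectory_continuous[OF assms(1)] trajectory_Gr[OF assms(1)] assms(2)]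
    trajectory_square[OF assms(1)] by (intro set_integral_add(1) set_integrable_divide)

lemma cost_integrable:
  assumes "(y, k, a) \<in> \<Gamma> t x" "0 \<le> t" "t \<le> r" "s \<le> T"
  shows "(\<lambda>s. cost y a s) integrable_on {r..s}"
  using set_lebesgue_integral_eq_integral(1)[OF cost_absolutely_integrable[OF assms(1,2)]] assms(3,4)
  by (rule integrable_on_subinterval_real)

lemma square_integrable:
  assumes "(y, k, a) \<in> \<Gamma> t x" "t \<le> r" "s \<le> T"
  shows "(\<lambda>s. (a s)\<^sup>2) integrable_on {r..s}"
  using set_lebesgue_integral_eq_integral(1)[OF trajectory_square[OF assms(1)]] assms(2,3)
  by (rule integrable_on_subinterval_real)

lemma Jcost_eq:
  assumes "(y, k, a) \<in> \<Gamma> t x" "0 \<le> t"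
  shows "J t (y, k, a) = integral {t..T} (\<lambda>s. cost y a s) + g (y T)"
  unfolding Jcost_def
  using set_lebesgue_integral_eq_integral(2)[OF cost_absolutely_integrable[OF assms]] by simp

lemma Jcost_split:
  assumes "(y, k, a) \<in> \<Gamma> t x" "0 \<le> t" "t \<le> r" "r \<le> T"
  shows "J t (y, k, a) = integral {t..r} (\<lambda>s. cost y a s) + J r (y, k, a)"
  using Jcost_eq[OF assms(1,2)] Jcost_eq[OF trajectory_tail[OF assms(1,3,4)]] assms(2-4)
    Henstock_Kurzweil_Integration.integral_combine[OF assms(3,4) cost_integrable[OF assms(1,2)]]
  by auto

text \<open>Coercivity, with a constant common to all trajectories: \<open>L\<close> and
  \<open>g\<close> are bounded. It makes the infimum finite and bounds the energy of nearly optimal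
  trajectories.\<close>

lemma Jcost_ge_energy:
  obtains C where "C \<ge> 0" "\<And>y k a t x. (y, k, a) \<in> \<Gamma> t x \<Longrightarrow> 0 \<le> t \<Longrightarrow> t \<le> T \<Longrightarrow>
     integral {t..T} (\<lambda>s. (a s)\<^sup>2) / 2 - C \<le> J t (y, k, a)"
proof -
  obtain C where C: "C \<ge> 0" "\<And>x s. x \<in> Gr N e \<Longrightarrow> s \<in> {0..T} \<Longrightarrow> \<bar>L x s\<bar> \<le> C"
    "\<And>x. x \<in> Gr N e \<Longrightarrow> \<bar>g x\<bar> \<le> C"
    using running_and_final_bound by blast
  have "integral {t..T} (\<lambda>s. (a s)\<^sup>2) / 2 - (C * \<bar>T\<bar> + C) \<le> J t (y, k, a)"
    if G: "(y, k, a) \<in> \<Gamma> t x" and t: "0 \<le> t" "t \<le> T" for y k a t x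
  proof -
    have sq: "(\<lambda>s. (a s)\<^sup>2 / 2) integrable_on {t..T}"
      using square_integrable[OF G, of t T] by (intro integrable_on_divide) auto
    have "integral {t..T} (\<lambda>s. (a s)\<^sup>2) / 2 - C * (T - t) = integral {t..T} (\<lambda>s. (a s)\<^sup>2 / 2 - C)"
      using sq t by (subst integral_diff) (auto simp: integral_divide)
    also have "\<dots> \<le> integral {t..T} (\<lambda>s. cost y a s)"
    proof (rule integral_le)
      show "(\<lambda>s. (a s)\<^sup>2 / 2 - C) integrable_on {t..T}" using sq by (intro integrable_diff) auto
      show "(\<lambda>s. cost y a s) integrable_on {t..T}" using cost_integrable[OF G] t by auto
      show "(a s)\<^sup>2 / 2 - C \<le> cost y a s" if "s \<in> {t..T}" for s
        using C(2)[OF trajectory_Gr[OF G that], of s] that t by auto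
    qed
    finally have "integral {t..T} (\<lambda>s. (a s)\<^sup>2) / 2 - C * (T - t) + g (y T) \<le> J t (y, k, a)"
      using Jcost_eq[OF G t(1)] by simp
    moreover have "- C \<le> g (y T)" using C(3)[OF trajectory_Gr[OF G, of T]] t by auto
    moreover have "C * (T - t) \<le> C * \<bar>T\<bar>" using C(1) t by (intro mult_left_mono) auto
    ultimately show ?thesis by linarith
  qed
  then show ?thesis using that[of "C * \<bar>T\<bar> + C"] C(1) by auto
qed

lemma bdd_below_Jcost:
  assumes "0 \<le> t" "t \<le> T" shows "bdd_below (J t ` \<Gamma> t x)"
proof -
  obtain C where C: "\<And>y k a. (y, k, a) \<in> \<Gamma> t x \<Longrightarrow>
     integral {t..T} (\<lambda>s. (a s)\<^sup>2) / 2 - C \<le> J t (y, k, a)"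
    using Jcost_ge_energy assms by metis
  show ?thesis
  proof (rule bdd_belowI2)
    fix z assume "z \<in> \<Gamma> t x"
    then obtain y k a where z: "z = (y, k, a)" "(y, k, a) \<in> \<Gamma> t x" by (metis prod_cases3)
    have "integral {t..T} (\<lambda>s. (a s)\<^sup>2) \<ge> 0"
      using square_integrable[OF z(2)] by (intro integral_nonneg) auto
    then show "- C \<le> J t z" using C[OF z(2)] z(1) by simp
  qed
qed

lemma value_le_Jcost:
  assumes "(y, k, a) \<in> \<Gamma> t x" "0 \<le> t" "t < T"
  shows "u x t \<le> J t (y, k, a)"
  unfolding ufun_def using assms bdd_below_Jcost[of t x] by (auto intro!: cInf_lower)

text \<open>One half of dynamic programming: the tail of an admissible trajectory is admissible for
  its own starting point.\<close>

lemma value_ge_prefix: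
  assumes "(y, k, a) \<in> \<Gamma> t x" "0 \<le> t" "t \<le> r" "r < T"
  shows "integral {t..r} (\<lambda>s. cost y a s) + u (y r) r \<le> J t (y, k, a)"
  using Jcost_split[OF assms(1-3)] value_le_Jcost[OF trajectory_tail[OF assms(1,3)]] assms by simp

section \<open>Explicit competitors: a constant control followed by an arbitrary
  continuation\<close>

lemma inM_ray:
  assumes "i \<in> {1..N}" "x \<in> Jray e i" shows "inM N e x (i, c)"
  using assms unfolding inM_def by auto

lemma inM_nonzeroD:
  assumes "inM N e x (k, c)" "x \<noteq> 0" "j \<in> {1..N}" "x \<in> Jray e j"
  shows "k = j"
  using assms Jray_unique unfolding inM_def by fastforce

text \<open>Resting is encoded by speed 0 on edge \<open>i\<close>, which is allowed on all of the
  edge, whereas index 0 is allowed at O only.\<close>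

lemma stationary_in_Gamma:
  assumes "i \<in> {1..N}" "x \<in> Jray e i"
  shows "((\<lambda>_. x), (\<lambda>_. i), (\<lambda>_. 0)) \<in> \<Gamma> t x"
proof -
  have "velocity (\<lambda>_. i) (\<lambda>_. 0) = (\<lambda>_. 0)" unfolding velocity_def by auto
  then show ?thesis
    unfolding Gamma_iff using assms Jray_subset_Gr inM_ray by auto
qed

lemma Gamma_nonempty: "x \<in> Gr N e \<Longrightarrow> \<Gamma> t x \<noteq> {}"
  using GrE stationary_in_Gamma by (metis empty_iff)

text \<open>The distance to O is affine in time, so nonnegativity at the final time \<open>r\<close>
  suffices for the whole segment.\<close>

lemma segment_in_Jray:
  assumes "i \<in> {1..N}" "x \<in> Jray e i" "0 \<le> norm x + (r - t) * c" "s \<in> {t..r}"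
  shows "x + ((s - t) * c) *\<^sub>R e i \<in> Jray e i"
    and "norm (x + ((s - t) * c) *\<^sub>R e i) = norm x + (s - t) * c"
proof -
  have nonneg: "0 \<le> norm x + (s - t) * c"
  proof (cases "c \<ge> 0")
    case False
    then have "(r - t) * c \<le> (s - t) * c" using assms(4) by (intro mult_right_mono_neg) auto
    then show ?thesis using assms(3) by linarith
  qed (use assms(4) in auto)
  have eq: "x + ((s - t) * c) *\<^sub>R e i = (norm x + (s - t) * c) *\<^sub>R e i"
    using Jray_eq[OF assms(1,2)] by (metis scaleR_left_distrib)
  then show "x + ((s - t) * c) *\<^sub>R e i \<in> Jray e i" using Jray_scaleR[OF nonneg] by simp
  show "norm (x + ((s - t) * c) *\<^sub>R e i) = norm x + (s - t) * c"
    unfolding eq using nonneg norm_e[OF assms(1)] by simp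
qed

text \<open>The competitor behind the other half of dynamic programming: control \<open>c\<close>
  along edge \<open>i\<close> until \<open>r\<close>, then the given trajectory.\<close>

lemma straight_prefix:
  assumes i: "i \<in> {1..N}" and x: "x \<in> Jray e i" "0 \<le> norm x + (r - t) * c"
    and t: "0 \<le> t" "t < r" "r < T"
    and G2: "(y2, k2, a2) \<in> \<Gamma> r (x + ((r - t) * c) *\<^sub>R e i)"
    and bound: "\<And>s. s \<in> {t..r} \<Longrightarrow> L (x + ((s - t) * c) *\<^sub>R e i) s \<le> \<Lambda>"
  shows "u x t \<le> (r - t) * (\<Lambda> + c\<^sup>2 / 2) + J r (y2, k2, a2)"
proof -
  define p where "p s = x + ((s - t) * c) *\<^sub>R e i" for s
  define y where "y s = (if s < r then p s else y2 s)" for s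
  define k where "k s = (if s < r then i else k2 s)" for s
  define a where "a s = (if s < r then c else a2 s)" for s
  have right: "y s = y2 s" "k s = k2 s" "a s = a2 s" if "r \<le> s" for s
    using that by (auto simp: y_def k_def a_def)
  have p: "p s \<in> Jray e i" if "s \<in> {t..r}" for s
    unfolding p_def by (rule segment_in_Jray[OF i x that])
  have y_left: "y s = p s" if "s \<in> {t..r}" for s
    using that trajectory_start[OF G2] t by (cases "s = r") (auto simp: y_def p_def)
  have vel: "velocity k a = (\<lambda>s. if s < r then c *\<^sub>R e i else velocity k2 a2 s)"
    using i by (auto simp: velocity_def k_def a_def)
  note vel2 = trajectory_velocity[OF G2] less_imp_le[OF t(2)] less_imp_le[OF t(3)]
  have G: "(y, k, a) \<in> \<Gamma> t x"
    unfolding Gamma_iff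
  proof (intro conjI ballI)
    show "y s \<in> Gr N e" "k s \<le> N" if "s \<in> {t..T}" for s
      using that p[of s] Jray_subset_Gr[OF i] trajectory_Gr[OF G2, of s] trajectory_le_N[OF G2, of s] i
      by (auto simp: y_def k_def)
    show "k \<in> measurable (lebesgue_on {t..T}) (count_space UNIV)"
      using concat_measurable[OF trajectory_k_measurable[OF G2]] unfolding k_def by simp
    show "a \<in> borel_measurable (lebesgue_on {t..T})"
      using concat_measurable[OF trajectory_a_measurable[OF G2]] unfolding a_def by simp
    show "AE s in lebesgue. s \<in> {t..T} \<longrightarrow> inM N e (y s) (k s, a s)"
      \<comment> \<open>Before \<open>r\<close> the constraint holds at every time, even if the
        segment touches O, where every index is allowed; from \<open>r\<close> on it is
        inherited.\<close>
      using trajectory_inM[OF G2]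
    proof eventually_elim
      case (elim s)
      then show ?case
        using p[of s] inM_ray[OF i] by (auto simp: y_def k_def a_def)
    qed
    have "(\<lambda>s. (a s)\<^sup>2) = (\<lambda>s. if s < r then c\<^sup>2 else (a2 s)\<^sup>2)" by (auto simp: a_def)
    then show "(\<lambda>s. (a s)\<^sup>2) absolutely_integrable_on {t..T}"
      using concat_absolutely_integrable[OF trajectory_square[OF G2]] t by simp
    show "velocity k a absolutely_integrable_on {t..T}"
      unfolding vel by (rule concat_absolutely_integrable[OF vel2])
    show "y s = x + integral {t..s} (velocity k a)" if s: "s \<in> {t..T}" for s
    proof (cases "s \<le> r")
      case True
      then show ?thesis
        using concat_integral_left[OF vel2, of s "c *\<^sub>R e i"] y_left[of s] s
        by (simp add: vel p_def)
    next
      case False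
      then show ?thesis
        using concat_integral_right[OF vel2, of s "c *\<^sub>R e i"] right(1)[of s] trajectory_eq[OF G2, of s] s
        by (simp add: vel p_def)
    qed
  qed
  have "J r (y, k, a) = J r (y2, k2, a2)"
  proof -
    have Gr: "(y, k, a) \<in> \<Gamma> r (y r)" using trajectory_tail[OF G] t by auto
    have "integral {r..T} (\<lambda>s. cost y a s) = integral {r..T} (\<lambda>s. cost y2 a2 s)"
      by (rule integral_cong) (simp add: right)
    then show ?thesis using Jcost_eq[OF Gr] Jcost_eq[OF G2] right(1)[of T] t by simp
  qed
  moreover have "integral {t..r} (\<lambda>s. cost y a s) \<le> (r - t) * (\<Lambda> + c\<^sup>2 / 2)"
  proof -
    have int: "(\<lambda>s. cost y a s) integrable_on {t..r}" using cost_integrable[OF G, of t r] t by simp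
    \<comment> \<open>At time \<open>r\<close> the control is already that of the continuation,
      hence the change on a single point.\<close>
    have "integral {t..r} (\<lambda>s. cost y a s) = integral {t..r} (\<lambda>s. L (y s) s + c\<^sup>2 / 2)"
      by (rule integral_spike[where S = "{r}"]) (auto simp: a_def)
    also have "\<dots> \<le> integral {t..r} (\<lambda>_. \<Lambda> + c\<^sup>2 / 2)"
    proof (rule integral_le)
      show "(\<lambda>s. L (y s) s + c\<^sup>2 / 2) integrable_on {t..r}"
        using int by (rule integrable_spike[where S = "{r}"]) (auto simp: a_def)
      show "L (y s) s + c\<^sup>2 / 2 \<le> \<Lambda> + c\<^sup>2 / 2" if "s \<in> {t..r}" for s
        using bound[OF that] y_left[OF that] by (simp add: p_def)
    qed auto
    also have "\<dots> = (r - t) * (\<Lambda> + c\<^sup>2 / 2)" using t by simp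
    finally show ?thesis .
  qed
  ultimately show ?thesis
    using value_le_Jcost[OF G] Jcost_split[OF G, of r] t by simp
qed

text \<open>Infimum of \<open>straight_prefix\<close> over all continuations; since r < T, this
  infimum is the value at the end of the segment.\<close>

lemma value_le_straight:
  assumes "i \<in> {1..N}" "x \<in> Jray e i" "0 \<le> norm x + (r - t) * c" "0 \<le> t" "t < r" "r < T"
    and "\<And>s. s \<in> {t..r} \<Longrightarrow> L (x + ((s - t) * c) *\<^sub>R e i) s \<le> \<Lambda>"
  shows "u x t \<le> (r - t) * (\<Lambda> + c\<^sup>2 / 2) + u (x + ((r - t) * c) *\<^sub>R e i) r"
proof -
  let ?z = "x + ((r - t) * c) *\<^sub>R e i"
  have "?z \<in> Gr N e"
    using Jray_subset_Gr[OF assms(1) segment_in_Jray(1)[OF assms(1-3), of r]] assms(5) by simp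
  then have "J r ` \<Gamma> r ?z \<noteq> {}" using Gamma_nonempty by simp
  moreover have "u x t - (r - t) * (\<Lambda> + c\<^sup>2 / 2) \<le> v" if "v \<in> J r ` \<Gamma> r ?z" for v
    using that straight_prefix[OF assms(1-6) _ assms(7)] by (auto simp: algebra_simps)
  ultimately have "u x t - (r - t) * (\<Lambda> + c\<^sup>2 / 2) \<le> Inf (J r ` \<Gamma> r ?z)"
    by (rule cInf_greatest)
  then show ?thesis using assms(6) unfolding ufun_def by simp
qed

section \<open>Energy estimates, nearly optimal trajectories, and legs on one edge\<close>

lemma control_absolutely_integrable:
  assumes "(y, k, a) \<in> \<Gamma> t x" shows "a absolutely_integrable_on {t..T}"
proof (rule measurable_bounded_by_integrable_imp_absolutely_integrable)
  \<comment> \<open>Integrability of the velocity would not do, as it forgets \<open>a\<close>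
    wherever the index is 0; the square dominates instead.\<close>
  show "(\<lambda>s. 1 + (a s)\<^sup>2) integrable_on {t..T}"
    using square_integrable[OF assms, of t T] by (intro integrable_add) auto
  show "norm (a s) \<le> 1 + (a s)\<^sup>2" for s
    using zero_le_power2[of "\<bar>a s\<bar> - 1"] by (simp add: power2_eq_square algebra_simps abs_mult_self_eq)
qed (use trajectory_a_measurable[OF assms] in auto)

text \<open>Young's inequality with a free weight \<beta>: a small \<beta> tames the energy, and
  then a short time tames the other term.\<close>

lemma displacement:
  assumes G: "(y, k, a) \<in> \<Gamma> t x" and s: "t \<le> s" "s \<le> T" and "\<beta> > 0"
  shows "norm (y s - x) \<le> \<beta> * integral {t..T} (\<lambda>s. (a s)\<^sup>2) + (s - t) / \<beta>"
proof -
  have vel: "velocity k a integrable_on {t..s}"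
    using set_lebesgue_integral_eq_integral(1)[OF trajectory_velocity[OF G]] s
    by (auto intro: integrable_on_subinterval_real)
  have sq: "(\<lambda>s. \<beta> * (a s)\<^sup>2) integrable_on {t..s}"
    using square_integrable[OF G, of t s] s by (intro integrable_on_mult_right) auto
  have "norm (y s - x) = norm (integral {t..s} (velocity k a))"
    using trajectory_eq[OF G, of s] s by simp
  also have "\<dots> \<le> integral {t..s} (\<lambda>s. \<beta> * (a s)\<^sup>2 + 1 / \<beta>)"
  proof (rule integral_norm_bound_integral[OF vel])
    show "(\<lambda>s. \<beta> * (a s)\<^sup>2 + 1 / \<beta>) integrable_on {t..s}"
      using sq by (intro integrable_add) auto
    show "norm (velocity k a \<tau>) \<le> \<beta> * (a \<tau>)\<^sup>2 + 1 / \<beta>" if "\<tau> \<in> {t..s}" for \<tau>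
    proof -
      have "k \<tau> \<le> N" using trajectory_le_N[OF G, of \<tau>] that s by auto
      then have "norm (velocity k a \<tau>) \<le> \<bar>a \<tau>\<bar>"
        using norm_e[of "k \<tau>"] by (auto simp: velocity_def)
      also have "\<bar>a \<tau>\<bar> \<le> \<beta> * (a \<tau>)\<^sup>2 + 1 / \<beta>"
      proof -
        \<comment> \<open>The square expands to \<beta> a^2 - 2 |a| + 1 / \<beta> after division;
          adding |a| leaves the wanted difference.\<close>
        have "0 \<le> (\<beta> * \<bar>a \<tau>\<bar> - 1)\<^sup>2 / \<beta> + \<bar>a \<tau>\<bar>" using \<open>\<beta> > 0\<close> by simp
        also have "\<dots> = \<beta> * (a \<tau>)\<^sup>2 + 1 / \<beta> - \<bar>a \<tau>\<bar>"
          using \<open>\<beta> > 0\<close> by (simp add: power2_eq_square field_simps abs_mult_self_eq)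
        finally show ?thesis by simp
      qed
      finally show ?thesis .
    qed
  qed
  also have "\<dots> = \<beta> * integral {t..s} (\<lambda>s. (a s)\<^sup>2) + (s - t) / \<beta>"
    using sq s by (subst integral_add) auto
  also have "integral {t..s} (\<lambda>s. (a s)\<^sup>2) \<le> integral {t..T} (\<lambda>s. (a s)\<^sup>2)"
    using square_integrable[OF G] s by (intro integral_subset_le) auto
  finally show ?thesis using \<open>\<beta> > 0\<close> by simp
qed

text \<open>The order of choices matters: an energy bound valid for every candidate fixes the
  duration \<open>h\<close>, and only then is a trajectory chosen with error at most \<epsilon>
  \<open>h\<close>. Dropping the tail by \<open>value_ge_prefix\<close> keeps this error.\<close>

lemma near_optimal:
  assumes x: "x \<in> Gr N e" and t: "0 \<le> t" "t < T" and "\<delta> > 0" "\<epsilon> > 0"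
  obtains r y k a where "t < r" "r < t + \<delta>" "r < T" "(y, k, a) \<in> \<Gamma> t x"
    "\<And>s. s \<in> {t..r} \<Longrightarrow> norm (y s - x) < \<delta>"
    "integral {t..r} (\<lambda>s. cost y a s) + u (y r) r \<le> u x t + \<epsilon> * (r - t)"
proof -
  obtain C where C: "\<And>y k a. (y, k, a) \<in> \<Gamma> t x \<Longrightarrow>
     integral {t..T} (\<lambda>s. (a s)\<^sup>2) / 2 - C \<le> J t (y, k, a)"
    using Jcost_ge_energy t by (metis less_imp_le)
  \<comment> \<open>Coercivity bounds half the energy by the cost plus \<open>C\<close>, and the
    cost stays below u + \<epsilon> T; the final 1 makes \<open>K\<close> positive.\<close>
  define K where "K = 2 * (\<bar>u x t\<bar> + \<bar>C\<bar> + \<epsilon> * T) + 1"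
  have "K > 0" unfolding K_def by (intro add_nonneg_pos mult_nonneg_nonneg add_nonneg_nonneg) (use assms in auto)
  \<comment> \<open>This choice makes \<beta> \<open>K\<close> equal to \<delta> / 2, and
    \<open>h\<close> then adds at most \<delta> / 4 to the displacement.\<close>
  define \<beta> where "\<beta> = \<delta> / (2 * K)"
  have "\<beta> > 0" unfolding \<beta>_def using \<open>K > 0\<close> \<open>\<delta> > 0\<close> by simp
  define h where "h = min (\<delta> / 2) (min (\<beta> * \<delta> / 4) ((T - t) / 2))"
  have h: "h > 0" "h < \<delta>" "h < T - t" "h / \<beta> \<le> \<delta> / 4"
  proof -
    have le: "h \<le> \<delta> / 2" "h \<le> \<beta> * \<delta> / 4" "h \<le> (T - t) / 2"
      unfolding h_def by (meson min.cobounded1 min.cobounded2 order_trans)+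
    show "h > 0" using \<open>\<beta> > 0\<close> \<open>\<delta> > 0\<close> t unfolding h_def by simp
    show "h < \<delta>" using le(1) \<open>\<delta> > 0\<close> by linarith
    have "(T - t) / 2 < T - t" using t by simp
    then show "h < T - t" using le(3) by (rule le_less_trans[rotated])
    show "h / \<beta> \<le> \<delta> / 4" using le(2) \<open>\<beta> > 0\<close> by (simp add: field_simps)
  qed
  have "Inf (J t ` \<Gamma> t x) < u x t + \<epsilon> * h"
    using t \<open>\<epsilon> > 0\<close> h(1) unfolding ufun_def by simp
  then obtain v where "v \<in> J t ` \<Gamma> t x" "v < u x t + \<epsilon> * h"
    using cInf_lessD Gamma_nonempty[OF x] by (metis image_is_empty)
  then obtain y k a where G: "(y, k, a) \<in> \<Gamma> t x" and J: "J t (y, k, a) < u x t + \<epsilon> * h"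
    by (auto simp: image_iff)
  have "\<epsilon> * h \<le> \<epsilon> * T" using h t \<open>\<epsilon> > 0\<close> by (intro mult_left_mono) auto
  then have energy: "integral {t..T} (\<lambda>s. (a s)\<^sup>2) \<le> K"
    using C[OF G] J abs_ge_self[of "u x t"] abs_ge_self[of C] unfolding K_def by argo
  show ?thesis
  proof (rule that[of "t + h" y k a])
    show "t < t + h" "t + h < t + \<delta>" "t + h < T" using h by auto
    show "(y, k, a) \<in> \<Gamma> t x" by (rule G)
    show "norm (y s - x) < \<delta>" if s: "s \<in> {t..t + h}" for s
    proof -
      have "norm (y s - x) \<le> \<beta> * integral {t..T} (\<lambda>s. (a s)\<^sup>2) + (s - t) / \<beta>"
        using displacement[OF G _ _ \<open>\<beta> > 0\<close>, of s] s h by auto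
      also have "\<dots> \<le> \<beta> * K + h / \<beta>"
        using energy s \<open>\<beta> > 0\<close> by (intro add_mono mult_left_mono divide_right_mono) auto
      also have "\<beta> * K = \<delta> / 2" unfolding \<beta>_def using \<open>K > 0\<close> by simp
      finally show ?thesis using h \<open>\<delta> > 0\<close> by linarith
    qed
    show "integral {t..t + h} (\<lambda>s. cost y a s) + u (y (t + h)) (t + h) \<le> u x t + \<epsilon> * (t + h - t)"
      using value_ge_prefix[OF G t(1), of "t + h"] h J by simp
  qed
qed

text \<open>Off O the edges are disjoint and relatively closed, so a connected piece of path
  avoiding O lies on one edge \<open>j\<close>. There the constraint forces index \<open>j\<close>,
  the motion is scalar, and Jensen bounds the energy below by that of the mean velocity. Only the
  half-open interval has to avoid O, so the leg may start at the last visit.\<close>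

lemma leg_on_ray:
  assumes G: "(y, k, a) \<in> \<Gamma> t x" and r: "t \<le> r" "r < s" "s \<le> T"
    and nz: "\<And>\<tau>. \<tau> \<in> {r<..s} \<Longrightarrow> y \<tau> \<noteq> 0"
  obtains j where "j \<in> {1..N}" "\<And>\<tau>. \<tau> \<in> {r..s} \<Longrightarrow> y \<tau> \<in> Jray e j"
    "((norm (y s) - norm (y r)) / (s - r))\<^sup>2 * (s - r) \<le> integral {r..s} (\<lambda>\<tau>. (a \<tau>)\<^sup>2)"
proof -
  let ?I = "{r<..s}"
  have cont: "continuous_on {r..s} y"
    by (rule continuous_on_subset[OF trajectory_continuous[OF G]]) (use r in auto)
  then have cont': "continuous_on ?I y" by (rule continuous_on_subset) auto
  have Gr: "y \<tau> \<in> Gr N e" if "\<tau> \<in> {r..s}" for \<tau> using trajectory_Gr[OF G] that r by auto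
  obtain j where j: "j \<in> {1..N}" "y s \<in> Jray e j" using GrE[OF Gr[of s]] r by auto
  \<comment> \<open>A separation of the time interval: edge \<open>j\<close>, found at the final
    time, against all other edges.\<close>
  let ?P = "?I \<inter> y -` Jray e j" and ?Q = "?I \<inter> y -` (\<Union>i\<in>{1..N} - {j}. Jray e i)"
  have "closedin (top_of_set ?I) ?P" "closedin (top_of_set ?I) ?Q"
    using cont' closed_Jray j(1) by (auto intro!: continuous_closedin_preimage closed_UN)
  moreover have cover: "?I \<subseteq> ?P \<union> ?Q"
  proof
    fix \<tau> assume \<tau>: "\<tau> \<in> ?I"
    then obtain i where "i \<in> {1..N}" "y \<tau> \<in> Jray e i" using GrE[OF Gr[of \<tau>]] by auto
    then show "\<tau> \<in> ?P \<union> ?Q" using \<tau> by (cases "i = j") blast+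
  qed
  moreover have "?P \<inter> ?Q = {}" using Jray_unique j(1) nz by blast
  moreover have "?P \<noteq> {}" using j(2) r by auto
  moreover have "connected ?I" by simp
  ultimately have "?Q = {}" unfolding connected_closedin by metis
  then have P: "?I \<subseteq> {r..s} \<inter> y -` Jray e j" using cover by auto
  have "closed ({r..s} \<inter> y -` Jray e j)"
    using cont closed_Jray[OF j(1)] by (intro continuous_closed_preimage) auto
  \<comment> \<open>The closure adds the time \<open>r\<close>, where the path may be at O.\<close>
  then have "closure ?I \<subseteq> {r..s} \<inter> y -` Jray e j" using P by (rule closure_minimal[rotated])
  then have ray: "y \<tau> \<in> Jray e j" if "\<tau> \<in> {r..s}" for \<tau>
    using that r by auto
  have a_int: "a integrable_on {r..s}"
    using set_lebesgue_integral_eq_integral(1)[OF control_absolutely_integrable[OF G]] r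
    by (auto intro: integrable_on_subinterval_real)
  have "AE \<tau> in lebesgue. \<tau> \<in> ?I \<longrightarrow> k \<tau> = j"
    using trajectory_inM[OF G]
  proof eventually_elim
    case (elim \<tau>)
    then show ?case using inM_nonzeroD[of "y \<tau>" "k \<tau>" "a \<tau>" j] nz[of \<tau>] ray[of \<tau>] j(1) r by auto
  qed
  then obtain Z where Z: "Z \<in> null_sets lebesgue" "{\<tau>. \<not> (\<tau> \<in> ?I \<longrightarrow> k \<tau> = j)} \<subseteq> Z"
    unfolding eventually_ae_filter by auto
  have neg: "negligible (insert r Z)" using Z(1) by (simp add: negligible_iff_null_sets)
  have "integral {r..s} (velocity k a) = integral {r..s} (\<lambda>\<tau>. a \<tau> *\<^sub>R e j)"
  proof (rule integral_spike[OF neg])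
    fix \<tau> assume "\<tau> \<in> {r..s} - insert r Z"
    then have "\<tau> \<in> ?I" "\<tau> \<notin> Z" by auto
    then have "k \<tau> = j" using Z(2) by blast
    then show "a \<tau> *\<^sub>R e j = velocity k a \<tau>" using j(1) by (simp add: velocity_def)
  qed
  also have "\<dots> = integral {r..s} a *\<^sub>R e j"
    using integral_linear[OF a_int bounded_linear_scaleR_left[of "e j"]] by (simp add: o_def)
  finally have "y s - y r = integral {r..s} a *\<^sub>R e j"
    using trajectory_increment[OF G r(1) less_imp_le[OF r(2)] r(3)] by simp
  moreover have "y s - y r = (norm (y s) - norm (y r)) *\<^sub>R e j"
    using Jray_eq[OF j(1) ray[of s]] Jray_eq[OF j(1) ray[of r]] r
    by (metis atLeastAtMost_iff less_imp_le order_refl scaleR_left_diff_distrib)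
  moreover have "e j \<noteq> 0" using norm_e[OF j(1)] by auto
  ultimately have \<rho>: "integral {r..s} a = norm (y s) - norm (y r)" by (metis scaleR_right_imp_eq)
  define m where "m = integral {r..s} a / (s - r)"
  have sq: "(\<lambda>\<tau>. (a \<tau>)\<^sup>2) integrable_on {r..s}" using square_integrable[OF G, of r s] r by simp
  \<comment> \<open>Jensen for the square, by integrating its tangent line at the mean
    \<open>m\<close>.\<close>
  have "integral {r..s} (\<lambda>\<tau>. 2 * m * a \<tau> - m\<^sup>2) \<le> integral {r..s} (\<lambda>\<tau>. (a \<tau>)\<^sup>2)"
  proof (rule integral_le[OF _ sq])
    show "(\<lambda>\<tau>. 2 * m * a \<tau> - m\<^sup>2) integrable_on {r..s}"
      using a_int by (intro integrable_diff integrable_on_mult_right) auto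
    show "2 * m * a \<tau> - m\<^sup>2 \<le> (a \<tau>)\<^sup>2" for \<tau>
      using zero_le_power2[of "a \<tau> - m"] by (simp add: power2_eq_square algebra_simps)
  qed
  also have "integral {r..s} (\<lambda>\<tau>. 2 * m * a \<tau> - m\<^sup>2) = 2 * m * integral {r..s} a - m\<^sup>2 * (s - r)"
    using a_int r by (subst integral_diff) (auto intro: integrable_on_mult_right)
  also have "integral {r..s} a = m * (s - r)" using r unfolding m_def by simp
  also have "2 * m * (m * (s - r)) - m\<^sup>2 * (s - r) = m\<^sup>2 * (s - r)" by (simp add: power2_eq_square)
  finally show ?thesis using that[OF j(1) ray] unfolding m_def \<rho> by simp
qed

section \<open>Viscosity inequalities\<close>

lemma C1junction_expansion:
  assumes C1: "C1junction N e T phi Dx Dt" and i: "i \<in> {1..N}" "x \<in> Jray e i"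
    and t: "t \<in> {0..T}" and "\<eta> > 0"
  shows "\<exists>\<delta>>0. \<forall>y s. y \<in> Jray e i \<longrightarrow> s \<in> {0..T} \<longrightarrow> norm (y - x) < \<delta> \<longrightarrow> \<bar>s - t\<bar> < \<delta> \<longrightarrow>
    \<bar>phi y s - phi x t - Dx i (norm x) t * (norm y - norm x) - Dt i (norm x) t * (s - t)\<bar>
      \<le> \<eta> * (\<bar>norm y - norm x\<bar> + \<bar>s - t\<bar>)"
proof -
  let ?r = "norm x"
  have "((\<lambda>(r', t'). phi (r' *\<^sub>R e i) t') has_derivative
      (\<lambda>(h, k). Dx i ?r t * h + Dt i ?r t * k)) (at (?r, t) within {0..} \<times> {0..T})"
    using C1 i(1) t unfolding C1junction_def by auto
  then obtain d where d: "d > 0" and dd: "\<And>z. z \<in> {0..} \<times> {0..T} \<Longrightarrow> norm (z - (?r, t)) < d \<Longrightarrow>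
      norm ((case z of (r', t') \<Rightarrow> phi (r' *\<^sub>R e i) t') - phi (?r *\<^sub>R e i) t -
        (case z - (?r, t) of (h, k) \<Rightarrow> Dx i ?r t * h + Dt i ?r t * k)) \<le> \<eta> * norm (z - (?r, t))"
    using \<open>\<eta> > 0\<close> unfolding has_derivative_within_alt by fastforce
  have "\<bar>phi y s - phi x t - Dx i ?r t * (norm y - ?r) - Dt i ?r t * (s - t)\<bar>
      \<le> \<eta> * (\<bar>norm y - ?r\<bar> + \<bar>s - t\<bar>)"
    if *: "y \<in> Jray e i" "s \<in> {0..T}" "norm (y - x) < d / 2" "\<bar>s - t\<bar> < d / 2" for y s
  proof -
    have le: "norm ((norm y, s) - (?r, t)) \<le> \<bar>norm y - ?r\<bar> + \<bar>s - t\<bar>"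
      by (simp add: norm_Pair sqrt_sum_squares_le_sum_abs)
    also have "\<dots> < d" using norm_diff_Jray[OF i(1) *(1) i(2)] * by simp
    finally have "\<bar>phi y s - phi x t - (Dx i ?r t * (norm y - ?r) + Dt i ?r t * (s - t))\<bar>
        \<le> \<eta> * norm ((norm y, s) - (?r, t))"
      using dd[of "(norm y, s)"] *(2) Jray_eq[OF i(1) *(1)] Jray_eq[OF i] by simp
    also have "\<dots> \<le> \<eta> * (\<bar>norm y - ?r\<bar> + \<bar>s - t\<bar>)"
      using le \<open>\<eta> > 0\<close> by (intro mult_left_mono) auto
    finally show ?thesis by (simp add: algebra_simps)
  qed
  then show ?thesis using d by (intro exI[of _ "d / 2"]) auto
qed

text \<open>All restrictions of the test function share the values at O, so their time derivatives
  there are derivatives of one function. For interior \<open>t\<close> this derivative is two-sided,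
  hence unique.\<close>

lemma Dt_at_vertex:
  assumes C1: "C1junction N e T phi Dx Dt" and i: "i \<in> {1..N}" "j \<in> {1..N}" and t: "t \<in> {0<..<T}"
  shows "Dt i 0 t = Dt j 0 t"
proof -
  have "((\<lambda>s. phi 0 s) has_real_derivative Dt i 0 t) (at t)" if i: "i \<in> {1..N}" for i
  proof -
    have "((\<lambda>(r', t'). phi (r' *\<^sub>R e i) t') has_derivative
        (\<lambda>(h, k). Dx i 0 t * h + Dt i 0 t * k)) (at (0, t) within {0..} \<times> {0..T})"
      using C1 i t unfolding C1junction_def by auto
    then have "((\<lambda>(r', t'). phi (r' *\<^sub>R e i) t') has_derivative
        (\<lambda>(h, k). Dx i 0 t * h + Dt i 0 t * k)) (at (0, t) within Pair 0 ` {0..T})"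
      by (rule has_derivative_subset) auto
    moreover have "((\<lambda>s. (0::real, s)) has_derivative (\<lambda>s. (0, s))) (at t within {0..T})"
      by (auto intro!: derivative_eq_intros)
    ultimately have "((\<lambda>s. phi 0 s) has_derivative (\<lambda>k. Dt i 0 t * k)) (at t within {0..T})"
      using has_derivative_in_compose[of "Pair 0" "Pair 0" t "{0..T}"] by fastforce
    then show ?thesis
      using t by (simp add: at_within_Icc_at has_field_derivative_def)
  qed
  then show ?thesis using i DERIV_unique by blast
qed

lemma gdist_ray: "i \<in> {1..N} \<Longrightarrow> x \<in> Jray e i \<Longrightarrow> y \<in> Jray e i \<Longrightarrow> gdist N e x y = norm (x - y)"
  unfolding gdist_def by auto

text \<open>The running cost enters only through an upper limit \<open>l\<close> along the segment,
  so one proof covers moving on an edge, with its cost, and waiting at O, with \<open>lO\<close> and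
  speed 0.\<close>

lemma subsolution_along_ray:
  assumes C1: "C1junction N e T phi Dx Dt" and i: "i \<in> {1..N}" "x \<in> Jray e i"
    and t: "t \<in> {0<..<T}" and max: "loc_max_at N e T (\<lambda>y s. u y s - phi y s) x t"
    and c: "x \<noteq> 0 \<or> 0 \<le> c"
    and l: "\<And>\<eta>. \<eta> > 0 \<Longrightarrow> \<exists>\<delta>>0. \<forall>s. t \<le> s \<longrightarrow> s < t + \<delta> \<longrightarrow> L (x + ((s - t) * c) *\<^sub>R e i) s \<le> l + \<eta>"
  shows "- Dt i (norm x) t + (- Dx i (norm x) t * c - c\<^sup>2 / 2 - l) \<le> 0" (is "?z \<le> 0")
\<comment> \<open>One \<eta> comes from the running cost and 1 + |c| times \<eta> from the
  expansion.\<close>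
proof (rule le_zero_if_le_all_multiples[of "2 + \<bar>c\<bar>"])
  let ?p = "Dx i (norm x) t" and ?q = "Dt i (norm x) t"
  have t': "t \<in> {0..T}" using t by auto
  fix \<eta> :: real assume "0 < \<eta>"
  obtain d1 where d1: "d1 > 0"
    "\<And>s. t \<le> s \<Longrightarrow> s < t + d1 \<Longrightarrow> L (x + ((s - t) * c) *\<^sub>R e i) s \<le> l + \<eta>"
    using l[OF \<open>0 < \<eta>\<close>] by blast
  obtain d2 where d2: "d2 > 0" "\<And>y s. y \<in> Jray e i \<Longrightarrow> s \<in> {0..T} \<Longrightarrow> norm (y - x) < d2 \<Longrightarrow> \<bar>s - t\<bar> < d2 \<Longrightarrow>
      \<bar>phi y s - phi x t - ?p * (norm y - norm x) - ?q * (s - t)\<bar> \<le> \<eta> * (\<bar>norm y - norm x\<bar> + \<bar>s - t\<bar>)"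
    using C1junction_expansion[OF C1 i t' \<open>0 < \<eta>\<close>] by blast
  obtain d3 where d3: "d3 > 0" "\<And>y s. y \<in> Gr N e \<Longrightarrow> s \<in> {0..T} \<Longrightarrow> gdist N e x y < d3 \<Longrightarrow> \<bar>s - t\<bar> < d3 \<Longrightarrow>
      u y s - phi y s \<le> u x t - phi x t"
    using max unfolding loc_max_at_def by blast
  \<comment> \<open>The last entry keeps an inward segment from passing O.\<close>
  define m where "m = Min {d1, d2, d3, T - t, if x = 0 then 1 else norm x}"
  have m: "m > 0" "m \<le> d1" "m \<le> d2" "m \<le> d3" "m \<le> T - t" "x = 0 \<or> m \<le> norm x"
    using d1(1) d2(1) d3(1) t unfolding m_def by auto
  \<comment> \<open>Both the duration \<open>h\<close> and the distance \<open>h\<close> |c| stay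
    below \<open>m\<close>.\<close>
  define h where "h = m / (2 * (\<bar>c\<bar> + 1))"
  have "h > 0" unfolding h_def using m(1) by simp
  have "h * (\<bar>c\<bar> + 1) = m / 2" unfolding h_def using abs_ge_zero[of c] by (simp add: field_simps)
  then have "h * \<bar>c\<bar> + h = m / 2" by (simp add: algebra_simps)
  moreover have "0 \<le> h * \<bar>c\<bar>" using \<open>h > 0\<close> by simp
  ultimately have h: "h < m" "h * \<bar>c\<bar> < m" using \<open>h > 0\<close> m(1) by linarith+
  define r where "r = t + h"
  have r: "t < r" "r < T" "r - t = h" using h(1) m(5) \<open>h > 0\<close> unfolding r_def by auto
  define y where "y = x + ((r - t) * c) *\<^sub>R e i"
  have "\<bar>h * c\<bar> = h * \<bar>c\<bar>" using \<open>h > 0\<close> by (simp add: abs_mult)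
  then have nonneg: "0 \<le> norm x + (r - t) * c"
    using c m(6) h(2) \<open>h > 0\<close> r(3) by (cases "x = 0") auto
  have y: "y \<in> Jray e i" "norm y = norm x + h * c"
    using segment_in_Jray[OF i nonneg, of r] r unfolding y_def by auto
  have dist: "norm (y - x) = h * \<bar>c\<bar>"
    using norm_diff_Jray[OF i(1) y(1) i(2)] y(2) \<open>\<bar>h * c\<bar> = h * \<bar>c\<bar>\<close> by simp
  have "u x t \<le> h * (l + \<eta> + c\<^sup>2 / 2) + u y r"
    unfolding y_def r(3)[symmetric]
    using t r h(1) m(2) d1(2) by (intro value_le_straight[OF i nonneg]) auto
  moreover have "u y r - phi y r \<le> u x t - phi x t"
    using d3(2)[OF Jray_subset_Gr[OF i(1) y(1)], of r] gdist_ray[OF i y(1)] dist h m(4) r t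
    by (simp add: norm_minus_commute)
  moreover have "\<bar>phi y r - phi x t - ?p * (h * c) - ?q * h\<bar> \<le> \<eta> * (h * \<bar>c\<bar> + h)"
    using d2(2)[OF y(1), of r] dist h m(3) r t y(2) \<open>\<bar>h * c\<bar> = h * \<bar>c\<bar>\<close> by simp
  ultimately have "h * ?z \<le> h * (\<eta> * (2 + \<bar>c\<bar>))" by (simp add: algebra_simps abs_le_iff)
  then show "?z \<le> \<eta> * (2 + \<bar>c\<bar>)" using \<open>h > 0\<close> by simp
qed auto

text \<open>The left endpoint is excluded from the hypothesis because the path may be at O there,
  with a running cost below that of the edge it enters; one point does not affect the
  integral.\<close>

lemma cost_ge:
  assumes G: "(y, k, a) \<in> \<Gamma> t x" and t: "0 \<le> t" "t \<le> r" "r \<le> s" "s \<le> T"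
    and l: "\<And>\<tau>. \<tau> \<in> {r<..s} \<Longrightarrow> l \<le> L (y \<tau>) \<tau>"
  shows "(s - r) * l + integral {r..s} (\<lambda>\<tau>. (a \<tau>)\<^sup>2) / 2 \<le> integral {r..s} (\<lambda>\<tau>. cost y a \<tau>)"
proof -
  let ?f = "\<lambda>\<tau>. if \<tau> = r then l + (a \<tau>)\<^sup>2 / 2 else cost y a \<tau>"
  have sq: "(\<lambda>\<tau>. (a \<tau>)\<^sup>2 / 2) integrable_on {r..s}"
    using square_integrable[OF G t(2,4)] by (rule integrable_on_divide)
  have "(s - r) * l + integral {r..s} (\<lambda>\<tau>. (a \<tau>)\<^sup>2) / 2 = integral {r..s} (\<lambda>\<tau>. l + (a \<tau>)\<^sup>2 / 2)"
    using sq t by (subst integral_add) (auto simp: integral_divide)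
  also have "\<dots> \<le> integral {r..s} ?f"
  proof (rule integral_le)
    show "(\<lambda>\<tau>. l + (a \<tau>)\<^sup>2 / 2) integrable_on {r..s}" using sq by (intro integrable_add) auto
    show "?f integrable_on {r..s}"
      using cost_integrable[OF G t(1,2,4)] by (rule integrable_spike[where S = "{r}"]) auto
  qed (use l in auto)
  also have "\<dots> = integral {r..s} (\<lambda>\<tau>. cost y a \<tau>)"
    by (rule integral_spike[where S = "{r}"]) auto
  finally show ?thesis .
qed

text \<open>A radius of at most \<open>norm x\<close> keeps the trajectory off O, so the whole of
  [t, r] is a single leg, and the mean velocity may have either sign.\<close>

lemma supersolution_on_edge:
  assumes C1: "C1junction N e T phi Dx Dt" and i: "i \<in> {1..N}" "x \<in> Jray e i" and "x \<noteq> 0"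
    and t: "t \<in> {0<..<T}" and min: "loc_min_at N e T (\<lambda>y s. u y s - phi y s) x t"
    and H: "\<And>b. - Dx i (norm x) t * b - b\<^sup>2 / 2 - ell i x t \<le> H"
  shows "0 \<le> - Dt i (norm x) t + H"
proof -
  let ?p = "Dx i (norm x) t" and ?q = "Dt i (norm x) t"
  have t': "t \<in> {0..T}" and tt: "0 \<le> t" "t < T" using t by auto
  have "?q - H \<le> 0"
  proof (rule le_zero_if_le_all_multiples[of "2 * \<bar>?p\<bar> + 5"])
    fix \<eta> :: real assume \<eta>: "0 < \<eta>" "\<eta> \<le> 1"
    obtain d1 where d1: "d1 > 0" "\<And>y s. y \<in> Jray e i \<Longrightarrow> s \<in> {0..T} \<Longrightarrow> norm (y - x) < d1 \<Longrightarrow> \<bar>s - t\<bar> < d1 \<Longrightarrow>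
       \<bar>ell i y s - ell i x t\<bar> < \<eta>"
      using ell_near[OF i t' \<eta>(1)] by blast
    obtain d2 where d2: "d2 > 0" "\<And>y s. y \<in> Jray e i \<Longrightarrow> s \<in> {0..T} \<Longrightarrow> norm (y - x) < d2 \<Longrightarrow> \<bar>s - t\<bar> < d2 \<Longrightarrow>
        \<bar>phi y s - phi x t - ?p * (norm y - norm x) - ?q * (s - t)\<bar> \<le> \<eta> * (\<bar>norm y - norm x\<bar> + \<bar>s - t\<bar>)"
      using C1junction_expansion[OF C1 i t' \<eta>(1)] by blast
    obtain d3 where d3: "d3 > 0" "\<And>y s. y \<in> Gr N e \<Longrightarrow> s \<in> {0..T} \<Longrightarrow> gdist N e x y < d3 \<Longrightarrow> \<bar>s - t\<bar> < d3 \<Longrightarrow>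
        u x t - phi x t \<le> u y s - phi y s"
      using min unfolding loc_min_at_def by blast
    define \<delta> where "\<delta> = min (min d1 d2) (min d3 (norm x))"
    have \<delta>: "\<delta> > 0" "\<delta> \<le> d1" "\<delta> \<le> d2" "\<delta> \<le> d3" "\<delta> \<le> norm x"
      using d1(1) d2(1) d3(1) \<open>x \<noteq> 0\<close> unfolding \<delta>_def by auto
    obtain r y k a where r: "t < r" "r < t + \<delta>" "r < T" and G: "(y, k, a) \<in> \<Gamma> t x"
      and near: "\<And>s. s \<in> {t..r} \<Longrightarrow> norm (y s - x) < \<delta>"
      and opt: "integral {t..r} (\<lambda>s. cost y a s) + u (y r) r \<le> u x t + \<eta> * (r - t)"
      using near_optimal[OF Jray_subset_Gr[OF i] tt \<delta>(1) \<eta>(1)] by blast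
    have start: "y t = x" using trajectory_start[OF G] t by simp
    have nz: "y s \<noteq> 0" if "s \<in> {t..r}" for s using near[OF that] \<delta>(5) by auto
    obtain j where j: "j \<in> {1..N}" "\<And>s. s \<in> {t..r} \<Longrightarrow> y s \<in> Jray e j" and
      energy: "((norm (y r) - norm (y t)) / (r - t))\<^sup>2 * (r - t) \<le> integral {t..r} (\<lambda>\<tau>. (a \<tau>)\<^sup>2)"
      using leg_on_ray[OF G order_refl r(1) less_imp_le[OF r(3)]] nz by (metis greaterThanAtMost_iff atLeastAtMost_iff less_imp_le)
    have "j = i" using Jray_unique[OF j(1) i(1) j(2)[of t]] i start \<open>x \<noteq> 0\<close> r by simp
    then have ray: "y s \<in> Jray e i" if "s \<in> {t..r}" for s using j(2) that by simp
    have L: "ell i x t - \<eta> \<le> L (y s) s" if "s \<in> {t<..r}" for s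
    proof -
      have s: "s \<in> {t..r}" using that by simp
      have "\<bar>ell i (y s) s - ell i x t\<bar> < \<eta>"
        using d1(2)[OF ray[OF s], of s] near[OF s] s \<delta>(2) r t by simp
      then show ?thesis using L_ray[OF i(1) ray[OF s] nz[OF s], of s] by linarith
    qed
    have "(r - t) * (ell i x t - \<eta>) + integral {t..r} (\<lambda>\<tau>. (a \<tau>)\<^sup>2) / 2 \<le> integral {t..r} (\<lambda>\<tau>. cost y a \<tau>)"
      using L t r by (intro cost_ge[OF G]) auto
    moreover have "u x t - phi x t \<le> u (y r) r - phi (y r) r"
      using d3(2)[OF Jray_subset_Gr[OF i(1) ray], of r r] gdist_ray[OF i ray, of r] near[of r] \<delta>(4) r t
      by (simp add: norm_minus_commute)
    moreover have "\<bar>phi (y r) r - phi x t - ?p * (norm (y r) - norm x) - ?q * (r - t)\<bar>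
        \<le> \<eta> * (\<bar>norm (y r) - norm x\<bar> + (r - t))"
      using d2(2)[OF ray, of r r] near[of r] \<delta>(3) r t by simp
    ultimately have "(r - t) * (ell i x t - \<eta>) + ((norm (y r) - norm x) / (r - t))\<^sup>2 * (r - t) / 2 - \<eta> * (r - t)
        \<le> - ?p * (norm (y r) - norm x) - ?q * (r - t) + \<eta> * (\<bar>norm (y r) - norm x\<bar> + (r - t))"
      using opt energy unfolding start abs_le_iff by linarith
    \<comment> \<open>There is no waiting phase: the waiting cost, set to 0, is multiplied by zero
      duration.\<close>
    then show "?q - H \<le> \<eta> * (2 * \<bar>?p\<bar> + 5)"
      using supersolution_arith[of "r - t" "r - t" \<eta> 0 H "norm (y r) - norm x" ?p "ell i x t" ?q] H \<eta> r
      by simp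
  qed auto
  then show ?thesis by simp
qed

lemma supersolution_at_vertex:
  assumes C1: "C1junction N e T phi Dx Dt"
    and t: "t \<in> {0<..<T}" and min: "loc_min_at N e T (\<lambda>y s. u y s - phi y s) 0 t"
    and H0: "- lO t \<le> H"
    and H: "\<And>i b. i \<in> {1..N} \<Longrightarrow> 0 \<le> b \<Longrightarrow> - Dx i 0 t * b - b\<^sup>2 / 2 - ell i 0 t \<le> H"
  shows "0 \<le> - Dt 1 0 t + H"
proof -
  let ?p = "\<lambda>i. Dx i 0 t" and ?q = "Dt 1 0 t"
  \<comment> \<open>The edge of the final leg may change with \<eta>; \<open>B\<close> bounds the
    slopes on all edges, so the constant in front of \<eta> does not change with it.\<close>
  define B where "B = (\<Sum>i\<in>{1..N}. \<bar>?p i\<bar>)"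
  have "B \<ge> 0" unfolding B_def by (rule sum_nonneg) simp
  have B: "\<bar>?p i\<bar> \<le> B" if "i \<in> {1..N}" for i
    unfolding B_def by (rule member_le_sum) (use that in auto)
  have t': "t \<in> {0..T}" and tt: "0 \<le> t" "t < T" using t by auto
  have "0 \<in> Gr N e" using Jray_subset_Gr[OF _ zero_in_Jray, of 1] N1 by simp
  have "?q - H \<le> 0"
  proof (rule le_zero_if_le_all_multiples[of "2 * B + 5"])
    fix \<eta> :: real assume \<eta>: "0 < \<eta>" "\<eta> \<le> 1"
    obtain d1 where d1: "d1 > 0"
      "\<And>y s. y \<in> Gr N e \<Longrightarrow> s \<in> {0..T} \<Longrightarrow> norm y < d1 \<Longrightarrow> \<bar>s - t\<bar> < d1 \<Longrightarrow> lO t - \<eta> \<le> L y s"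
      "\<And>i y s. i \<in> {1..N} \<Longrightarrow> y \<in> Jray e i \<Longrightarrow> y \<noteq> 0 \<Longrightarrow> s \<in> {0..T} \<Longrightarrow> norm y < d1 \<Longrightarrow> \<bar>s - t\<bar> < d1 \<Longrightarrow>
         ell i 0 t - \<eta> \<le> L y s"
      using L_near_vertex[OF t' \<eta>(1)] by blast
    have "\<exists>d>0. \<forall>i\<in>{1..N}. \<forall>y s. y \<in> Jray e i \<longrightarrow> s \<in> {0..T} \<longrightarrow> norm (y - 0) < d \<longrightarrow> \<bar>s - t\<bar> < d \<longrightarrow>
        \<bar>phi y s - phi 0 t - Dx i (norm (0::'a)) t * (norm y - norm (0::'a)) - Dt i (norm (0::'a)) t * (s - t)\<bar>
          \<le> \<eta> * (\<bar>norm y - norm (0::'a)\<bar> + \<bar>s - t\<bar>)"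
    proof (rule common_radius)
      fix i assume "i \<in> {1..N}"
      then show "\<exists>d>0. \<forall>y s. y \<in> Jray e i \<longrightarrow> s \<in> {0..T} \<longrightarrow> norm (y - 0) < d \<longrightarrow> \<bar>s - t\<bar> < d \<longrightarrow>
        \<bar>phi y s - phi 0 t - Dx i (norm (0::'a)) t * (norm y - norm (0::'a)) - Dt i (norm (0::'a)) t * (s - t)\<bar>
          \<le> \<eta> * (\<bar>norm y - norm (0::'a)\<bar> + \<bar>s - t\<bar>)"
        by (rule C1junction_expansion[OF C1 _ zero_in_Jray t' \<eta>(1)])
    qed (simp, meson less_le_trans)
    then obtain d2 where d2: "d2 > 0" "\<And>i y s. i \<in> {1..N} \<Longrightarrow> y \<in> Jray e i \<Longrightarrow> s \<in> {0..T} \<Longrightarrow>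
        norm y < d2 \<Longrightarrow> \<bar>s - t\<bar> < d2 \<Longrightarrow>
        \<bar>phi y s - phi 0 t - ?p i * norm y - Dt i 0 t * (s - t)\<bar> \<le> \<eta> * (norm y + \<bar>s - t\<bar>)"
      by auto
    obtain d3 where d3: "d3 > 0" "\<And>y s. y \<in> Gr N e \<Longrightarrow> s \<in> {0..T} \<Longrightarrow> gdist N e 0 y < d3 \<Longrightarrow> \<bar>s - t\<bar> < d3 \<Longrightarrow>
        u 0 t - phi 0 t \<le> u y s - phi y s"
      using min unfolding loc_min_at_def by blast
    define \<delta> where "\<delta> = min d1 (min d2 d3)"
    have \<delta>: "\<delta> > 0" "\<delta> \<le> d1" "\<delta> \<le> d2" "\<delta> \<le> d3"
      using d1(1) d2(1) d3(1) unfolding \<delta>_def by auto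
    obtain r y k a where r: "t < r" "r < t + \<delta>" "r < T" and G: "(y, k, a) \<in> \<Gamma> t 0"
      and near0: "\<And>s. s \<in> {t..r} \<Longrightarrow> norm (y s - 0) < \<delta>"
      and opt: "integral {t..r} (\<lambda>s. cost y a s) + u (y r) r \<le> u 0 t + \<eta> * (r - t)"
      using near_optimal[OF \<open>0 \<in> Gr N e\<close> tt \<delta>(1) \<eta>(1)] by blast
    have near: "norm (y s) < \<delta>" if "s \<in> {t..r}" for s using near0[OF that] by simp
    have start: "y t = 0" using trajectory_start[OF G] t by simp
    have Gr: "y s \<in> Gr N e" if "s \<in> {t..r}" for s using trajectory_Gr[OF G, of s] that r by simp
    have "closed ({t..r} \<inter> y -` {0})"
      using continuous_on_subset[OF trajectory_continuous[OF G], of "{t..r}"] r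
      by (intro continuous_closed_preimage) auto
    then have "compact ({t..r} \<inter> y -` {0})"
      by (metis Int_lower1 bounded_closed_interval bounded_subset compact_eq_bounded_closed)
    moreover have "t \<in> {t..r} \<inter> y -` {0}" using start r by simp
    then have "{t..r} \<inter> y -` {0} \<noteq> {}" by blast
    ultimately obtain w where "w \<in> {t..r} \<inter> y -` {0}" and le_w: "\<forall>s\<in>{t..r} \<inter> y -` {0}. s \<le> w"
      using compact_attains_sup by blast
    then have w: "w \<in> {t..r}" "y w = 0" by simp_all
    have last: "s \<le> w" if "s \<in> {t..r}" "y s = 0" for s using le_w that by simp
    \<comment> \<open>Before the last visit only the waiting cost is kept: the kinetic energy of any
      excursions is nonnegative and is dropped.\<close>
    have before: "(w - t) * (lO t - \<eta>) \<le> integral {t..w} (\<lambda>\<tau>. cost y a \<tau>)"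
    proof -
      have "lO t - \<eta> \<le> L (y s) s" if "s \<in> {t<..w}" for s
        using d1(2)[OF Gr, of s s] near[of s] that \<delta>(2) w r t by simp
      then have "(w - t) * (lO t - \<eta>) + integral {t..w} (\<lambda>\<tau>. (a \<tau>)\<^sup>2) / 2 \<le> integral {t..w} (\<lambda>\<tau>. cost y a \<tau>)"
        using t w r by (intro cost_ge[OF G]) auto
      moreover have "0 \<le> integral {t..w} (\<lambda>\<tau>. (a \<tau>)\<^sup>2)"
        using square_integrable[OF G, of t w] w r by (intro integral_nonneg) auto
      ultimately show ?thesis by simp
    qed
    \<comment> \<open>Both branches of the distance from O give \<open>norm (y r)\<close>, so no
      edge needs to be known here.\<close>
    have min': "u 0 t - phi 0 t \<le> u (y r) r - phi (y r) r"
      using d3(2)[OF Gr, of r r] near[of r] \<delta>(4) r t unfolding gdist_def by (auto split: if_splits)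
    have expand: "\<bar>phi (y r) r - phi 0 t - ?p j * norm (y r) - ?q * (r - t)\<bar> \<le> \<eta> * (norm (y r) + (r - t))"
      if "j \<in> {1..N}" "y r \<in> Jray e j" for j
      using d2(2)[OF that, of r] near[of r] \<delta>(3) r t Dt_at_vertex[OF C1 that(1) _ t, of 1] N1 by simp
    show "?q - H \<le> \<eta> * (2 * B + 5)"
    proof (cases "w = r")
      \<comment> \<open>There is no final leg, and only the bound by the waiting Hamiltonian is
        available; cost, near-optimality and expansion lose \<eta> each.\<close>
      case True
      have "?p 1 * norm (y r) = 0" using w True by simp
      then have "(r - t) * (lO t - \<eta>) - \<eta> * (r - t) \<le> - ?q * (r - t) + \<eta> * (r - t)"
        using before min' expand[of 1] zero_in_Jray N1 opt w(2) unfolding True abs_le_iff by auto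
      then have "(r - t) * (?q + lO t) \<le> (r - t) * (3 * \<eta>)" by (simp add: algebra_simps)
      then have "?q + lO t \<le> 3 * \<eta>" using r by simp
      moreover have "3 * \<eta> \<le> \<eta> * (2 * B + 5)" using \<open>B \<ge> 0\<close> \<eta> by (simp add: algebra_simps)
      ultimately show ?thesis using H0 by linarith
    next
      case False
      then have "w < r" "t \<le> w" using w by auto
      have nz: "y s \<noteq> 0" if "s \<in> {w<..r}" for s using last[of s] that \<open>t \<le> w\<close> by auto
      obtain j where j: "j \<in> {1..N}" "\<And>s. s \<in> {w..r} \<Longrightarrow> y s \<in> Jray e j" and
        energy: "((norm (y r) - norm (y w)) / (r - w))\<^sup>2 * (r - w) \<le> integral {w..r} (\<lambda>\<tau>. (a \<tau>)\<^sup>2)"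
        using leg_on_ray[OF G \<open>t \<le> w\<close> \<open>w < r\<close> less_imp_le[OF r(3)] nz] by metis
      have "ell j 0 t - \<eta> \<le> L (y s) s" if "s \<in> {w<..r}" for s
        using d1(3)[OF j(1) j(2)[of s] nz[OF that], of s] near[of s] that \<delta>(2) w r t by simp
      then have "(r - w) * (ell j 0 t - \<eta>) + integral {w..r} (\<lambda>\<tau>. (a \<tau>)\<^sup>2) / 2 \<le> integral {w..r} (\<lambda>\<tau>. cost y a \<tau>)"
        using t w r by (intro cost_ge[OF G]) auto
      moreover have "integral {t..w} (\<lambda>\<tau>. cost y a \<tau>) + integral {w..r} (\<lambda>\<tau>. cost y a \<tau>) = integral {t..r} (\<lambda>\<tau>. cost y a \<tau>)"
        using w r t cost_integrable[OF G, of t r] by (intro Henstock_Kurzweil_Integration.integral_combine) auto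
      ultimately have "(w - t) * (lO t - \<eta>) + ((r - w) * (ell j 0 t - \<eta>) + (norm (y r) / (r - w))\<^sup>2 * (r - w) / 2) - \<eta> * (r - t)
        \<le> - ?p j * norm (y r) - ?q * (r - t) + \<eta> * (norm (y r) + (r - t))"
        using opt energy before min' expand[OF j(1) j(2)[of r]] w(2) \<open>w < r\<close> unfolding abs_le_iff by simp
      moreover have "(w - t) * (- lO t) \<le> (w - t) * H"
        using H0 \<open>t \<le> w\<close> by (intro mult_left_mono) auto
      moreover have "r - t - (r - w) = w - t" by simp
      \<comment> \<open>The leg starts at O, so its mean velocity is nonnegative and
        \<open>H\<close> applies.\<close>
      moreover have "- ?p j * b - b\<^sup>2 / 2 - ell j 0 t \<le> H" if "b \<in> {0, norm (y r) / (r - w)}" for b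
        using that \<open>w < r\<close> by (intro H[OF j(1)]) auto
      ultimately have "?q - H \<le> \<eta> * (2 * \<bar>?p j\<bar> + 5)"
        using \<eta> \<open>w < r\<close> \<open>t \<le> w\<close>
        by (intro supersolution_arith[of "r - w" "r - t" \<eta> "lO t" H "norm (y r)" "?p j" "ell j 0 t" ?q]) simp_all
      also have "\<dots> \<le> \<eta> * (2 * B + 5)" using B[OF j(1)] \<eta> by (intro mult_left_mono) auto
      finally show ?thesis .
    qed
  qed (use \<open>B \<ge> 0\<close> in auto)
  then show ?thesis by simp
qed

text \<open>By continuity of the edge cost and \<open>L_le_ell\<close>, the cost along a short
  segment is nearly at most \<open>ell i x t\<close>, even from O; at O only outward speeds are
  possible.\<close>

lemma subsolution_moving:
  assumes C1: "C1junction N e T phi Dx Dt" and i: "i \<in> {1..N}" "x \<in> Jray e i" and c: "x \<noteq> 0 \<or> 0 \<le> c"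
    and t: "t \<in> {0<..<T}" and max: "loc_max_at N e T (\<lambda>y s. u y s - phi y s) x t"
  shows "- Dt i (norm x) t + (- Dx i (norm x) t * c - c\<^sup>2 / 2 - ell i x t) \<le> 0"
proof (rule subsolution_along_ray[OF C1 i t max c])
  have t': "t \<in> {0..T}" using t by auto
  fix \<eta> :: real assume "\<eta> > 0"
  then obtain d where d: "d > 0" "\<And>y s. y \<in> Jray e i \<Longrightarrow> s \<in> {0..T} \<Longrightarrow> norm (y - x) < d \<Longrightarrow>
      \<bar>s - t\<bar> < d \<Longrightarrow> \<bar>ell i y s - ell i x t\<bar> < \<eta>"
    using ell_near[OF i t'] by blast
  define m where "m = min d (min (T - t) (if x = 0 then 1 else norm x))"
  have m: "m > 0" "m \<le> d" "m \<le> T - t" "x = 0 \<or> m \<le> norm x"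
    using d(1) t unfolding m_def by auto
  \<comment> \<open>Durations below \<open>h\<close> keep both elapsed time and distance below
    \<open>m\<close>.\<close>
  define h where "h = m / (\<bar>c\<bar> + 1)"
  have "h > 0" unfolding h_def using m(1) by simp
  have "\<bar>c\<bar> + 1 \<noteq> 0" using abs_ge_zero[of c] by linarith
  then have "h * (\<bar>c\<bar> + 1) = m" unfolding h_def by simp
  then have "h * \<bar>c\<bar> + h = m" by (simp add: algebra_simps)
  have "0 \<le> h * \<bar>c\<bar>" using \<open>h > 0\<close> by simp
  have "L (x + ((s - t) * c) *\<^sub>R e i) s \<le> ell i x t + \<eta>" if s: "t \<le> s" "s < t + h" for s
  proof -
    let ?y = "x + ((s - t) * c) *\<^sub>R e i"
    have "(s - t) * \<bar>c\<bar> \<le> h * \<bar>c\<bar>" using s by (intro mult_right_mono) auto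
    then have le: "(s - t) * \<bar>c\<bar> < m" "s - t < m"
      using \<open>h > 0\<close> \<open>h * \<bar>c\<bar> + h = m\<close> \<open>0 \<le> h * \<bar>c\<bar>\<close> s by linarith+
    have abs: "\<bar>(s - t) * c\<bar> = (s - t) * \<bar>c\<bar>" using s by (simp add: abs_mult)
    have "0 \<le> norm x + (s - t) * c"
      using c m(4) le(1) abs s by (cases "x = 0") auto
    then have y: "?y \<in> Jray e i" using segment_in_Jray(1)[OF i, of s t c s] s by simp
    have "norm (?y - x) < d" using norm_e[OF i(1)] abs le(1) m(2) by simp
    then have "\<bar>ell i ?y s - ell i x t\<bar> < \<eta>"
      using d(2)[OF y, of s] le(2) m(2,3) s t by auto
    then show ?thesis using L_le_ell[OF i(1) y, of s] by linarith
  qed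
  then show "\<exists>\<delta>>0. \<forall>s. t \<le> s \<longrightarrow> s < t + \<delta> \<longrightarrow> L (x + ((s - t) * c) *\<^sub>R e i) s \<le> ell i x t + \<eta>"
    using \<open>h > 0\<close> by blast
qed

text \<open>Resting at O costs \<open>lO\<close>, possibly less than every edge cost; this
  competitor yields the waiting term of \<open>HO\<close>.\<close>

lemma subsolution_waiting:
  assumes C1: "C1junction N e T phi Dx Dt"
    and t: "t \<in> {0<..<T}" and max: "loc_max_at N e T (\<lambda>y s. u y s - phi y s) 0 t"
  shows "- Dt 1 0 t - lO t \<le> 0"
proof -
  have one: "1 \<in> {1..N}" using N1 by simp
  have "\<exists>\<delta>>0. \<forall>s. t \<le> s \<longrightarrow> s < t + \<delta> \<longrightarrow> L (0 + ((s - t) * 0) *\<^sub>R e 1) s \<le> lO t + \<eta>"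
    if \<eta>: "\<eta> > 0" for \<eta>
  proof -
    have t': "t \<in> {0..T}" using t by auto
    then obtain d where d: "d > 0" "\<And>s. s \<in> {0..T} \<Longrightarrow> \<bar>s - t\<bar> < d \<Longrightarrow> \<bar>lO s - lO t\<bar> < \<eta>"
      using lO_near[OF _ \<eta>] by blast
    have "L 0 s \<le> lO t + \<eta>" if "t \<le> s" "s < t + min d (T - t)" for s
    proof -
      have "s \<in> {0..T}" "\<bar>s - t\<bar> < d" using that t by auto
      then show ?thesis using d(2)[of s] L_0[of s] by linarith
    qed
    then show ?thesis using d(1) t by (intro exI[of _ "min d (T - t)"]) auto
  qed
  from subsolution_along_ray[OF C1 one zero_in_Jray t max _ this] show ?thesis by simp
qed

end

theorem mainTheorem7:
  fixes N :: nat and e :: "nat \<Rightarrow> 'a::euclidean_space" and T :: real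
    and ell :: "nat \<Rightarrow> 'a \<Rightarrow> real \<Rightarrow> real" and ells :: "real \<Rightarrow> real"
    and gi :: "nat \<Rightarrow> 'a \<Rightarrow> real" and gs :: real
  assumes N2: "N \<ge> 2"
    and unit: "\<forall>i\<in>{1..N}. norm (e i) = 1"
    and distinct: "inj_on e {1..N}"
    and Tpos: "T > 0"
    and ell_cont: "\<forall>i\<in>{1..N}. continuous_on (Jray e i \<times> {0..T}) (\<lambda>(x, t). ell i x t)"
    and ell_bdd: "\<forall>i\<in>{1..N}. bounded ((\<lambda>(x, t). ell i x t) ` (Jray e i \<times> {0..T}))"
    and g_cont: "\<forall>i\<in>{1..N}. continuous_on (Jray e i) (gi i)"
    and g_bdd: "\<forall>i\<in>{1..N}. bounded (gi i ` Jray e i)"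
    and ells_cont: "continuous_on {0..T} ells"
    and ells_bdd: "bounded (ells ` {0..T})"
  shows "(\<forall>x\<in>Gr N e. ufun N e ell ells gi gs T x T = gfun N e gi gs x) \<and>
    (\<forall>phi Dx Dt x t. C1junction N e T phi Dx Dt \<and> x \<in> Gr N e \<and> t \<in> {0<..<T} \<longrightarrow>
       (loc_max_at N e T (\<lambda>y s. ufun N e ell ells gi gs T y s - phi y s) x t \<longrightarrow>
          (x = 0 \<longrightarrow> - Dt 1 0 t + HO N ell ells t (\<lambda>i. Dx i 0 t) \<le> 0) \<and>
          (\<forall>i\<in>{1..N}. x \<in> Jray e i - {0} \<longrightarrow>
              - Dt i (norm x) t + Hi ell i x t (Dx i (norm x) t) \<le> 0)) \<and>
       (loc_min_at N e T (\<lambda>y s. ufun N e ell ells gi gs T y s - phi y s) x t \<longrightarrow>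
          (x = 0 \<longrightarrow> - Dt 1 0 t + HO N ell ells t (\<lambda>i. Dx i 0 t) \<ge> 0) \<and>
          (\<forall>i\<in>{1..N}. x \<in> Jray e i - {0} \<longrightarrow>
              - Dt i (norm x) t + Hi ell i x t (Dx i (norm x) t) \<ge> 0)))"
proof -
  interpret junction N e T ell ells gi gs
    using assms by unfold_locales auto
  have one: "1 \<in> {1..N}" using N2 by simp
  have terminal: "ufun N e ell ells gi gs T x T = gfun N e gi gs x" for x
    unfolding ufun_def by simp
  \<comment> \<open>The bounds for single controls pass to the supremum, and the time derivative
    along edge \<open>i\<close> is traded for that along edge 1.\<close>
  have sub0: "- Dt 1 0 t + HO N ell ells t (\<lambda>i. Dx i 0 t) \<le> 0"
    if "C1junction N e T phi Dx Dt" "t \<in> {0<..<T}" "loc_max_at N e T (\<lambda>y s. u y s - phi y s) 0 t"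
    for phi Dx Dt t
  proof -
    have "Hdown ell i t (Dx i 0 t) \<le> Dt 1 0 t" if i: "i \<in> {1..N}" for i
      unfolding Hdown_def
    proof (rule cSUP_least)
      show "- Dx i 0 t * a - a\<^sup>2 / 2 - ell i 0 t \<le> Dt 1 0 t" if "a \<in> {0..}" for a
        using subsolution_moving[OF \<open>C1junction N e T phi Dx Dt\<close> i zero_in_Jray _ \<open>t \<in> {0<..<T}\<close>, of a]
          Dt_at_vertex[OF \<open>C1junction N e T phi Dx Dt\<close> i one \<open>t \<in> {0<..<T}\<close>] that
          \<open>loc_max_at N e T (\<lambda>y s. u y s - phi y s) 0 t\<close> by simp
    qed simp
    then have "Max ((\<lambda>i. Hdown ell i t (Dx i 0 t)) ` {1..N}) \<le> Dt 1 0 t"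
      using one by (intro Max.boundedI) auto
    then show ?thesis using subsolution_waiting[OF that] unfolding HO_def by simp
  qed
  have subE: "- Dt i (norm x) t + Hi ell i x t (Dx i (norm x) t) \<le> 0"
    if "C1junction N e T phi Dx Dt" "t \<in> {0<..<T}" "loc_max_at N e T (\<lambda>y s. u y s - phi y s) x t"
      "i \<in> {1..N}" "x \<in> Jray e i - {0}" for phi Dx Dt t i x
  proof -
    have "Hi ell i x t (Dx i (norm x) t) \<le> Dt i (norm x) t"
      unfolding Hi_def
    proof (rule cSUP_least)
      show "- Dx i (norm x) t * a - a\<^sup>2 / 2 - ell i x t \<le> Dt i (norm x) t" for a
        using subsolution_moving[OF that(1,4) _ _ that(2,3), of a] that(5) by simp
    qed simp
    then show ?thesis by simp
  qed
  have sup0: "0 \<le> - Dt 1 0 t + HO N ell ells t (\<lambda>i. Dx i 0 t)"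
    if "C1junction N e T phi Dx Dt" "t \<in> {0<..<T}" "loc_min_at N e T (\<lambda>y s. u y s - phi y s) 0 t"
    for phi Dx Dt t
  proof (rule supersolution_at_vertex[OF that])
    show "- lO t \<le> HO N ell ells t (\<lambda>i. Dx i 0 t)" unfolding HO_def by simp
    show "- Dx i 0 t * b - b\<^sup>2 / 2 - ell i 0 t \<le> HO N ell ells t (\<lambda>i. Dx i 0 t)"
      if "i \<in> {1..N}" "0 \<le> b" for i b
      using Hdown_ge[OF that(2)] Hdown_le_HO[OF that(1)] by (rule order_trans)
  qed
  have supE: "0 \<le> - Dt i (norm x) t + Hi ell i x t (Dx i (norm x) t)"
    if "C1junction N e T phi Dx Dt" "t \<in> {0<..<T}" "loc_min_at N e T (\<lambda>y s. u y s - phi y s) x t"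
      "i \<in> {1..N}" "x \<in> Jray e i - {0}" for phi Dx Dt t i x
    by (rule supersolution_on_edge[OF that(1,4) _ _ that(2,3)]) (use that(5) Hi_ge in auto)
  show ?thesis
  proof (intro conjI ballI allI impI, goal_cases)
    case (1 x)
    show ?case by (rule terminal)
  next
    case (2 phi Dx Dt x t)
    then show ?case using sub0[of phi Dx Dt t] by simp
  next
    case (3 phi Dx Dt x t i)
    then show ?case using subE[of phi Dx Dt t x i] by blast
  next
    case (4 phi Dx Dt x t)
    then show ?case using sup0[of phi Dx Dt t] by simp
  next
    case (5 phi Dx Dt x t i)
    then show ?case using supE[of phi Dx Dt t x i] by blast
  qed
qed

end
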